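(* Let $n\ge 1$, $c\ge 2$ be integers and $\alpha\neq\beta$ colors in $\{1,\dots,c\}$. Then $\left|\Pi_n^{eq}\wr C_c(1^\alpha2^\alpha3^\beta)\right|$ equals $$B(n)(c-1)^n+\sum_{i=1}^n\binom{n}{i}\sum_{j=0}^{n-i}\binom{n-i}{j}B(n-i-j)(c-1)^{n-i}$$ $$+\sum_{1\le i<j\le n}\sum_{a,b}\sum_{d,e}\sum_{f,g}\binom{i-1}{a,b}\binom{j-i-1}{d,e}\binom{n-j}{f,g}B(n-a-b-d-e-f-g-2)(c-2)^{n-j-f-g}(c-1)^{j-d-2}c^{d+f+g}$$ $$+\sum_{1\le i<j<k\le n}\sum_{a,b}\sum_{d,e}\sum_{f,g}\sum_{\ell,m}\sum_p\binom{i-1}{a,b}\binom{j-i-1}{d,e}\binom{k-j-1}{f,g}\binom{n-k}{\ell,m}\binom{n-a-b-d-e-f-g-\ell-m-3}{p}$$ $$\cdot B(n-a-b-d-e-f-g-\ell-m-p-3)(c-2)^{k-j-f-g-1}(c-1)^{n-k-d+j-2}c^{d+f+g}.$$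
   Context: $\Pi_n\wr C_c$ is the set of colored set partitions of $[n]$: a set partition of $[n]$ together with a color in $\{1,\dots,c\}$ for each element. A colored partition eq-contains $1^\alpha2^\alpha3^\beta$ iff there are elements $x<y<z$ lying in three distinct blocks with $x,y$ colored $\alpha$ and $z$ colored $\beta$; $\Pi_n^{eq}\wr C_c(1^\alpha2^\alpha3^\beta)$ is the set of those that do not. $B(m)$ is the $m$-th Bell number. Summation conventions: $\sum_{x,y}$ and $\sum_x$ range over all nonnegative integers; $\binom{N}{x,y}=\frac{N!}{x!\,y!\,(N-x-y)!}$ when $x+y\le N$ and $0$ otherwise; $\binom{N}{p}=0$ unless $0\le p\le N$; $0^0=1$. *)

theory Defs
  imports Complex_Main "HOL-Library.FuncSet" "HOL-Library.Disjoint_Sets"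
begin

definition Bell :: "nat \<Rightarrow> nat" where
  "Bell m = card {P. partition_on {1..m} P}"

(* The division is exact. *)
definition trinomial :: "nat \<Rightarrow> nat \<Rightarrow> nat \<Rightarrow> nat" where
  "trinomial N x y =
     (if x + y \<le> N then fact N div (fact x * fact y * fact (N - x - y)) else 0)"

(* The colouring is extensional on {1..n}, so that each coloured partition is represented
   by exactly one pair. *)
definition colored_partitions :: "nat \<Rightarrow> nat \<Rightarrow> (nat set set \<times> (nat \<Rightarrow> nat)) set" where
  "colored_partitions n c = {P. partition_on {1..n} P} \<times> ({1..n} \<rightarrow>\<^sub>E {1..c})"

definition eq_contains_aab :: "nat \<Rightarrow> nat \<Rightarrow> nat set set \<times> (nat \<Rightarrow> nat) \<Rightarrow> bool" where
  "eq_contains_aab \<alpha> \<beta> = (\<lambda>(P, col).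
     \<exists>X\<in>P. \<exists>Y\<in>P. \<exists>Z\<in>P. X \<noteq> Y \<and> X \<noteq> Z \<and> Y \<noteq> Z \<and>
       (\<exists>x\<in>X. \<exists>y\<in>Y. \<exists>z\<in>Z. x < y \<and> y < z \<and> col x = \<alpha> \<and> col y = \<alpha> \<and> col z = \<beta>))"

definition eq_avoiders_aab ::
    "nat \<Rightarrow> nat \<Rightarrow> nat \<Rightarrow> nat \<Rightarrow> (nat set set \<times> (nat \<Rightarrow> nat)) set" where
  "eq_avoiders_aab n c \<alpha> \<beta> = {\<pi> \<in> colored_partitions n c. \<not> eq_contains_aab \<alpha> \<beta> \<pi>}"

end

theory Submission
  imports Defs
begin

text \<open>
  Call a block an \<open>\<alpha>\<close>-block if it contains an element coloured \<open>\<alpha>\<close>. The first two terms of the formula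
  count the coloured partitions with no and with exactly one \<open>\<alpha>\<close>-block, which all avoid the pattern.
  Otherwise let \<open>i\<close> be the first element coloured \<open>\<alpha>\<close> and \<open>X\<close> its block, let \<open>j\<close> be the first element
  coloured \<open>\<alpha>\<close> outside \<open>X\<close> and \<open>Y\<close> its block, and let \<open>k\<close> be the first element coloured \<open>\<alpha>\<close> outside
  \<open>X \<union> Y\<close>, with \<open>k = n + 1\<close> if there is none. Avoidance then means exactly that \<open>\<beta>\<close> occurs neither after
  \<open>j\<close> outside \<open>X \<union> Y\<close> nor anywhere after \<open>k\<close>. For fixed \<open>i, j, k, X, Y\<close> the admissible colours of the
  elements are independent of each other and of the partition of the complement of \<open>X \<union> Y\<close>, and the
  trinomials count how \<open>X\<close> and \<open>Y\<close> meet the intervals cut out by \<open>i, j, k\<close>. For \<open>k \<le> n\<close> the sum over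
  \<open>p\<close> is the Bell recurrence applied to the block of \<open>k\<close>.
\<close>

section \<open>Set partitions and Bell numbers\<close>

text \<open>Relabelling along a bijection with \<open>{1..card A}\<close> carries blocks to blocks,
  and the inverse relabelling undoes it, so only the size of the ground set matters.\<close>

lemma card_partitions_eq_Bell:
  assumes "finite A"
  shows "card {P. partition_on A P} = Bell (card A)"
proof -
  obtain h where h: "bij_betw h A {1..card A}"
    using assms by (metis card_atLeastAtMost diff_Suc_1 finite_atLeastAtMost finite_same_card_bij)
  define h' where "h' = inv_into A h"
  have h': "bij_betw h' {1..card A} A"
    unfolding h'_def by (rule bij_betw_inv_into[OF h])
  have image: "partition_on (f ` C) ((`) f ` P)" if "inj_on f C" "partition_on C P"
    for f :: "'c \<Rightarrow> 'd" and C P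
  proof -
    \<comment> \<open>\<open>partition_on_inj_image\<close> discards the empty set from the image;
      no block is empty, so nothing is lost.\<close>
    have "(`) f ` P - {{}} = (`) f ` P"
      using partition_onD3[OF that(2)] by auto
    then show ?thesis
      using partition_on_inj_image[OF that(2,1)] by simp
  qed
  have round_trip: "(`) g ` (`) f ` P = P"
    if "partition_on C P" "\<And>x. x \<in> C \<Longrightarrow> g (f x) = x"
    for f :: "'c \<Rightarrow> 'd" and g C P
  proof -
    have "g ` f ` X = X" if "X \<in> P" for X
    proof -
      have "X \<subseteq> C"
        using \<open>X \<in> P\<close> \<open>partition_on C P\<close> by (auto simp: partition_on_def)
      then have "(\<lambda>x. g (f x)) ` X = (\<lambda>x. x) ` X"
        using \<open>\<And>x. x \<in> C \<Longrightarrow> g (f x) = x\<close> by (intro image_cong) auto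
      then show ?thesis
        by (simp add: image_image)
    qed
    then show ?thesis
      by (simp add: image_image)
  qed
  have "bij_betw (\<lambda>P. (`) h ` P) {P. partition_on A P} {P. partition_on {1..card A} P}"
  proof (rule bij_betwI[where g = "\<lambda>P. (`) h' ` P"])
    show "(\<lambda>P. (`) h ` P) \<in> {P. partition_on A P} \<rightarrow> {P. partition_on {1..card A} P}"
      using image[of h A] h by (auto simp: bij_betw_def)
    show "(\<lambda>P. (`) h' ` P) \<in> {P. partition_on {1..card A} P} \<rightarrow> {P. partition_on A P}"
      using image[of h' "{1..card A}"] h' by (auto simp: bij_betw_def)
    show "(`) h' ` (`) h ` P = P" if "P \<in> {P. partition_on A P}" for P
      by (rule round_trip[of A])
         (use that h in \<open>auto simp: h'_def bij_betw_def\<close>)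
    show "(`) h ` (`) h' ` P = P" if "P \<in> {P. partition_on {1..card A} P}" for P
      by (rule round_trip[of "{1..card A}"])
         (use that h in \<open>auto simp: h'_def bij_betw_def f_inv_into_f\<close>)
  qed
  then show ?thesis
    unfolding Bell_def by (rule bij_betw_same_card)
qed

text \<open>Deleting the prescribed blocks \<open>Q\<close> leaves an arbitrary partition of
  \<open>A - B\<close>, and adjoining \<open>Q\<close> again inverts this. Below, \<open>Q\<close>
  consists of one or two blocks.\<close>

lemma card_partitions_with_blocks:
  assumes "finite A" "partition_on B Q" "B \<subseteq> A"
  shows "card {P. partition_on A P \<and> Q \<subseteq> P} = Bell (card (A - B))"
proof -
  have "bij_betw (\<lambda>P. P - Q) {P. partition_on A P \<and> Q \<subseteq> P} {R. partition_on (A - B) R}"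
  proof (rule bij_betwI[where g = "\<lambda>R. R \<union> Q"])
    show "(\<lambda>P. P - Q) \<in> {P. partition_on A P \<and> Q \<subseteq> P} \<rightarrow> {R. partition_on (A - B) R}"
    proof safe
      fix P assume P: "partition_on A P" "Q \<subseteq> P"
      have "\<Union>(P - Q) = \<Union>P - \<Union>Q"
        using P by (fastforce simp: partition_on_def disjoint_def)
      then show "partition_on (A - B) (P - Q)"
        using P assms(2) by (auto simp: partition_on_def disjoint_def)
    qed
    show "(\<lambda>R. R \<union> Q) \<in> {R. partition_on (A - B) R} \<rightarrow> {P. partition_on A P \<and> Q \<subseteq> P}"
    proof safe
      fix R assume R: "partition_on (A - B) R"
      have "disjoint (R \<union> Q)"
        using R assms(2) by (intro disjoint_union) (auto simp: partition_on_def)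
      then show "partition_on A (R \<union> Q)"
        using R assms(2,3) by (auto simp: partition_on_def)
    qed
    show "R \<union> Q - Q = R" if "R \<in> {R. partition_on (A - B) R}" for R
    proof -
      have "X \<notin> Q" if "X \<in> R" for X
      proof
        assume "X \<in> Q"
        then have "X \<subseteq> B" "X \<subseteq> A - B"
          using that \<open>R \<in> _\<close> assms(2) by (auto simp: partition_on_def)
        then have "X = {}" by blast
        then show False
          using \<open>X \<in> Q\<close> assms(2) by (simp add: partition_on_def)
      qed
      then show ?thesis by auto
    qed
  qed auto
  then have "card {P. partition_on A P \<and> Q \<subseteq> P} = card {R. partition_on (A - B) R}"
    by (rule bij_betw_same_card)
  then show ?thesis
    using assms(1) by (simp add: card_partitions_eq_Bell)
qed

lemma partition_on_unique_block:
  assumes "partition_on A P" "X \<in> P" "Y \<in> P" "x \<in> X" "x \<in> Y"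
  shows "X = Y"
  using assms by (auto simp: partition_on_def disjoint_def)

text \<open>Subsets are grouped by size. The range may extend beyond \<open>card S\<close>, since
  the extra binomials vanish; this lets later sums run uniformly to \<open>n\<close>.\<close>

lemma sum_Pow_card:
  fixes F :: "nat \<Rightarrow> nat"
  assumes "finite S" "card S \<le> N"
  shows "(\<Sum>U\<in>Pow S. F (card U)) = (\<Sum>p\<le>N. (card S choose p) * F p)"
proof -
  have "(\<Sum>U\<in>Pow S. F (card U)) = (\<Sum>p\<le>N. \<Sum>U | U \<in> Pow S \<and> card U = p. F (card U))"
    using assms by (intro sum.group[symmetric]) (auto dest: card_mono)
  also have "\<dots> = (\<Sum>p\<le>N. (card S choose p) * F p)"
  proof (rule sum.cong[OF refl])
    fix p
    have "(\<Sum>U | U \<in> Pow S \<and> card U = p. F (card U)) = card {U. U \<subseteq> S \<and> card U = p} * F p"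
      by simp
    then show "(\<Sum>U | U \<in> Pow S \<and> card U = p. F (card U)) = (card S choose p) * F p"
      using n_subsets[OF assms(1)] by simp
  qed
  finally show ?thesis .
qed

text \<open>Partitions are sorted by the block \<open>insert (Suc m) U\<close> of the last element:
  \<open>p\<close> is the size of \<open>U\<close>, and the other \<open>m - p\<close> elements are
  partitioned freely.\<close>

lemma Bell_Suc:
  assumes "m \<le> N"
  shows "Bell (Suc m) = (\<Sum>p\<le>N. (m choose p) * Bell (m - p))"
proof -
  define A where "A = {1..Suc m}"
  define B where "B = {1..m}"
  have AB: "A = insert (Suc m) B" "Suc m \<notin> B" "finite A" "finite B" "card B = m"
    unfolding A_def B_def by auto
  have "{P. partition_on A P} = (\<Union>U\<in>Pow B. {P. partition_on A P \<and> {insert (Suc m) U} \<subseteq> P})"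
  proof -
    have "\<exists>U\<in>Pow B. insert (Suc m) U \<in> P" if P: "partition_on A P" for P
    proof -
      obtain X where X: "X \<in> P" "Suc m \<in> X"
        using partition_onD1[OF P] AB(1) by blast
      then have "insert (Suc m) (X - {Suc m}) \<in> P" "X - {Suc m} \<in> Pow B"
        using P AB(1) by (auto simp: partition_on_def insert_absorb)
      then show ?thesis by blast
    qed
    then show ?thesis by auto
  qed
  then have "card {P. partition_on A P} =
      card (\<Union>U\<in>Pow B. {P. partition_on A P \<and> {insert (Suc m) U} \<subseteq> P})"
    by simp
  also have "\<dots> = (\<Sum>U\<in>Pow B. card {P. partition_on A P \<and> {insert (Suc m) U} \<subseteq> P})"
  proof (rule card_UN_disjoint)
    show "\<forall>U\<in>Pow B. finite {P. partition_on A P \<and> {insert (Suc m) U} \<subseteq> P}"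
      using finitely_many_partition_on[OF AB(3)] by (auto intro: finite_subset[rotated])
    show "\<forall>U\<in>Pow B. \<forall>V\<in>Pow B. U \<noteq> V \<longrightarrow>
        {P. partition_on A P \<and> {insert (Suc m) U} \<subseteq> P} \<inter>
        {P. partition_on A P \<and> {insert (Suc m) V} \<subseteq> P} = {}"
    proof (intro ballI impI equals0I)
      fix U V P assume UV: "U \<in> Pow B" "V \<in> Pow B" "U \<noteq> V"
        and "P \<in> {P. partition_on A P \<and> {insert (Suc m) U} \<subseteq> P} \<inter>
          {P. partition_on A P \<and> {insert (Suc m) V} \<subseteq> P}"
      then have "insert (Suc m) U = insert (Suc m) V"
        by (intro partition_on_unique_block[of A P _ _ "Suc m"]) simp_all
      then show False
        using UV AB(2) by (metis Pow_iff insert_ident subsetD)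
    qed
  qed (use AB in auto)
  also have "\<dots> = (\<Sum>U\<in>Pow B. Bell (m - card U))"
  proof (rule sum.cong[OF refl])
    fix U assume U: "U \<in> Pow B"
    then have "A - insert (Suc m) U = B - U" "finite U"
      using AB by (auto intro: finite_subset)
    moreover have "card (B - U) = m - card U"
      using U AB \<open>finite U\<close> by (simp add: card_Diff_subset)
    ultimately show "card {P. partition_on A P \<and> {insert (Suc m) U} \<subseteq> P} = Bell (m - card U)"
      using card_partitions_with_blocks[OF AB(3), of "insert (Suc m) U" "{insert (Suc m) U}"] U AB(1)
      by (auto simp: partition_on_space)
  qed
  also have "\<dots> = (\<Sum>p\<le>N. (m choose p) * Bell (m - p))"
    using sum_Pow_card[of B N "\<lambda>p. Bell (m - p)"] AB assms by simp
  finally show ?thesis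
    using AB by (simp add: card_partitions_eq_Bell)
qed

section \<open>Pairs of disjoint subsets\<close>

text \<open>First \<open>a\<close> elements are chosen, then \<open>b\<close> of the remaining
  \<open>N - a\<close>. When \<open>a + b > N\<close>, one of the two binomials is zero, in
  accordance with the convention in \<open>trinomial\<close>.\<close>

lemma trinomial_eq_choose: "trinomial N a b = (N choose a) * ((N - a) choose b)"
proof (cases "a + b \<le> N")
  case True
  have "fact a * fact (N - a) * (N choose a) = fact N"
    using True by (intro binomial_fact_lemma) simp
  moreover have "fact b * fact (N - a - b) * ((N - a) choose b) = fact (N - a)"
    using True by (intro binomial_fact_lemma) simp
  ultimately have "fact N = (N choose a) * ((N - a) choose b) * (fact a * fact b * fact (N - a - b))"
    by (metis mult.assoc mult.commute)
  then show ?thesis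
    using True by (simp add: trinomial_def)
next
  case False
  then show ?thesis
    by (auto simp: trinomial_def binomial_eq_0)
qed

text \<open>The \<open>SIGMA\<close> form turns a sum over pairs into an iterated sum, over
  \<open>X\<close> and then over subsets of \<open>S - X\<close>, parallel to the trinomial as a
  product of two binomials.\<close>

definition disjoint_pairs :: "'a set \<Rightarrow> ('a set \<times> 'a set) set" where
  "disjoint_pairs S = (SIGMA X:Pow S. Pow (S - X))"

lemma disjoint_pairs_iff:
  "(X, Y) \<in> disjoint_pairs S \<longleftrightarrow> X \<subseteq> S \<and> Y \<subseteq> S \<and> X \<inter> Y = {}"
  by (auto simp: disjoint_pairs_def)

lemma finite_disjoint_pairs [simp]: "finite S \<Longrightarrow> finite (disjoint_pairs S)"
  by (auto simp: disjoint_pairs_def)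

lemma sum_disjoint_pairs_card:
  fixes F :: "nat \<Rightarrow> nat \<Rightarrow> nat"
  assumes "finite S" "card S \<le> N"
  shows "(\<Sum>(X, Y)\<in>disjoint_pairs S. F (card X) (card Y)) =
    (\<Sum>a\<le>N. \<Sum>b\<le>N. trinomial (card S) a b * F a b)"
proof -
  have "(\<Sum>(X, Y)\<in>disjoint_pairs S. F (card X) (card Y)) =
      (\<Sum>X\<in>Pow S. \<Sum>Y\<in>Pow (S - X). F (card X) (card Y))"
    unfolding disjoint_pairs_def using assms(1) by (subst sum.Sigma) auto
  also have "\<dots> = (\<Sum>X\<in>Pow S. \<Sum>b\<le>N. ((card S - card X) choose b) * F (card X) b)"
  proof (rule sum.cong[OF refl])
    fix X assume "X \<in> Pow S"
    then have "card (S - X) = card S - card X"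
      using assms(1) by (auto simp: card_Diff_subset finite_subset)
    then show "(\<Sum>Y\<in>Pow (S - X). F (card X) (card Y)) =
        (\<Sum>b\<le>N. ((card S - card X) choose b) * F (card X) b)"
      using sum_Pow_card[of "S - X" N "F (card X)"] assms by simp
  qed
  also have "\<dots> = (\<Sum>a\<le>N. (card S choose a) * (\<Sum>b\<le>N. ((card S - a) choose b) * F a b))"
    by (rule sum_Pow_card[OF assms])
  also have "\<dots> = (\<Sum>a\<le>N. \<Sum>b\<le>N. trinomial (card S) a b * F a b)"
    by (simp add: trinomial_eq_choose sum_distrib_left mult.assoc)
  finally show ?thesis .
qed

text \<open>Intersecting with \<open>S\<close> and \<open>T\<close> splits a pair into two
  independent pairs; pieces on different sides are disjoint anyway. Iteration cuts two blocks along
  several intervals.\<close>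

lemma sum_disjoint_pairs_Un:
  assumes "S \<inter> T = {}"
  shows "(\<Sum>(X, Y)\<in>disjoint_pairs (S \<union> T). G X Y) =
    (\<Sum>(A, B)\<in>disjoint_pairs S. \<Sum>(A', B')\<in>disjoint_pairs T. G (A \<union> A') (B \<union> B'))"
proof -
  have "(\<Sum>(X, Y)\<in>disjoint_pairs (S \<union> T). G X Y) =
      (\<Sum>((A, B), (A', B'))\<in>disjoint_pairs S \<times> disjoint_pairs T. G (A \<union> A') (B \<union> B'))"
  proof (rule sum.reindex_bij_witness[where
        i = "\<lambda>((A, B), (A', B')). (A \<union> A', B \<union> B')" and
        j = "\<lambda>(X, Y). ((X \<inter> S, Y \<inter> S), (X \<inter> T, Y \<inter> T))"], goal_cases)
    case (1 p)
    then show ?case by (cases p) (auto simp: disjoint_pairs_iff)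
  next
    case (2 p)
    then show ?case by (cases p) (auto simp: disjoint_pairs_iff)
  next
    case (3 q)
    moreover obtain A B A' B' where "q = ((A, B), (A', B'))" by (metis surj_pair)
    ultimately show ?case using assms by (auto simp: disjoint_pairs_iff)
  next
    case (4 q)
    moreover obtain A B A' B' where "q = ((A, B), (A', B'))" by (metis surj_pair)
    ultimately show ?case using assms by (simp add: disjoint_pairs_iff) blast
  next
    case (5 p)
    moreover obtain X Y where "p = (X, Y)" by fastforce
    ultimately have "X \<subseteq> S \<union> T" "Y \<subseteq> S \<union> T"
      by (simp_all add: disjoint_pairs_iff)
    then have "X \<inter> S \<union> X \<inter> T = X" "Y \<inter> S \<union> Y \<inter> T = Y"
      by blast+
    then show ?case by (simp add: \<open>p = (X, Y)\<close>)
  qed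
  then show ?thesis
    by (simp add: sum.cartesian_product case_prod_unfold)
qed

text \<open>This evaluates the number of colourings of one interval: \<open>u\<close>,
  \<open>v\<close>, \<open>w\<close> are the numbers of colours available on the first block, on the
  second block and outside both.\<close>

lemma prod_disjoint_pairs:
  fixes u v w :: nat
  assumes "finite S" "(A, B) \<in> disjoint_pairs S"
  shows "(\<Prod>x\<in>S. if x \<in> A then u else if x \<in> B then v else w) =
    u ^ card A * v ^ card B * w ^ (card S - card A - card B)"
proof -
  have AB: "finite A" "finite B" "A \<subseteq> S" "B \<subseteq> S" "A \<inter> B = {}"
    using assms by (auto simp: disjoint_pairs_iff finite_subset)
  define C where "C = S - (A \<union> B)"
  have C: "finite C" "A \<inter> (B \<union> C) = {}" "B \<inter> C = {}" and S: "S = A \<union> (B \<union> C)"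
    using AB assms(1) by (auto simp: C_def)
  have "card S = card A + (card B + card C)"
    unfolding S using AB C by (simp add: card_Un_disjoint)
  moreover have "(\<Prod>x\<in>A. if x \<in> A then u else if x \<in> B then v else w) = u ^ card A"
    by simp
  moreover have "(\<Prod>x\<in>B. if x \<in> A then u else if x \<in> B then v else w) = (\<Prod>x\<in>B. v)"
    using AB by (intro prod.cong) auto
  moreover have "(\<Prod>x\<in>C. if x \<in> A then u else if x \<in> B then v else w) = (\<Prod>x\<in>C. w)"
    by (rule prod.cong) (auto simp: C_def)
  moreover have "prod h S = prod h A * (prod h B * prod h C)" for h :: "'a \<Rightarrow> nat"
    unfolding S using AB C by (simp only: prod.union_disjoint finite_Un simp_thms)
  ultimately show ?thesis
    by simp
qed

section \<open>Families of avoiders with independent colours\<close>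

text \<open>\<open>I\<close> plays the role of the set of all elements coloured \<alpha>, and
  \<open>J\<close> that of the rest of the only \<alpha>-block.\<close>

definition single_block_family ::
    "nat \<Rightarrow> nat \<Rightarrow> nat \<Rightarrow> nat set \<Rightarrow> nat set \<Rightarrow> (nat set set \<times> (nat \<Rightarrow> nat)) set" where
  "single_block_family n c \<alpha> I J =
     {P. partition_on {1..n} P \<and> {I \<union> J} \<subseteq> P} \<times>
     (\<Pi>\<^sub>E x\<in>{1..n}. if x \<in> I then {\<alpha>} else {1..c} - {\<alpha>})"

text \<open>Here \<open>X\<close> and \<open>Y\<close> are the blocks of \<open>i\<close> and \<open>j\<close> without \<open>i\<close> and \<open>j\<close> themselves.\<close>

definition allowed_colors ::
    "nat \<Rightarrow> nat \<Rightarrow> nat \<Rightarrow> nat \<Rightarrow> nat \<Rightarrow> nat \<Rightarrow> nat set \<Rightarrow> nat set \<Rightarrow> nat \<Rightarrow> nat set" where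
  "allowed_colors c \<alpha> \<beta> i j k X Y x =
     (if x \<in> {i, j, k} then {\<alpha>}
      else if x < i then {1..c} - {\<alpha>}
      else if x < j then (if x \<in> X then {1..c} else {1..c} - {\<alpha>})
      else if x < k then (if x \<in> X \<union> Y then {1..c} else {1..c} - {\<alpha>, \<beta>})
      else {1..c} - {\<beta>})"

text \<open>As a product, the family can be counted factor by factor. For \<open>k = Suc n\<close>
  the conditions at and after \<open>k\<close> are vacuous, so the case of exactly two
  \<alpha>-blocks is included.\<close>

definition two_block_family ::
    "nat \<Rightarrow> nat \<Rightarrow> nat \<Rightarrow> nat \<Rightarrow> nat \<Rightarrow> nat \<Rightarrow> nat \<Rightarrow> nat set \<Rightarrow> nat set \<Rightarrow>
     (nat set set \<times> (nat \<Rightarrow> nat)) set" where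
  "two_block_family n c \<alpha> \<beta> i j k X Y =
     {P. partition_on {1..n} P \<and> {insert i X, insert j Y} \<subseteq> P} \<times>
     (\<Pi>\<^sub>E x\<in>{1..n}. allowed_colors c \<alpha> \<beta> i j k X Y x)"

lemma finite_partitions_with: "finite {P. partition_on {1..n::nat} P \<and> R P}"
  using finitely_many_partition_on[of "{1..n}"] by (auto intro: finite_subset[rotated])

lemma finite_single_block_family: "finite (single_block_family n c \<alpha> I J)"
  unfolding single_block_family_def
  by (intro finite_cartesian_product finite_PiE finite_partitions_with) auto

lemma finite_two_block_family: "finite (two_block_family n c \<alpha> \<beta> i j k X Y)"
  unfolding two_block_family_def
  by (intro finite_cartesian_product finite_PiE finite_partitions_with)
     (auto simp: allowed_colors_def)

text \<open>Only the complement of the fixed block is partitioned. The colour is forced on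
  \<open>I\<close> and has \<open>c - 1\<close> choices at each of the other
  \<open>n - card I\<close> elements.\<close>

lemma card_single_block_family:
  assumes "\<alpha> \<in> {1..c}" "(I, J) \<in> disjoint_pairs {1..n}" "I \<noteq> {}"
  shows "card (single_block_family n c \<alpha> I J) =
    Bell (n - card I - card J) * (c - 1) ^ (n - card I)"
proof -
  have IJ: "I \<subseteq> {1..n}" "J \<subseteq> {1..n}" "I \<inter> J = {}" "finite I" "finite J"
    using assms(2) by (auto simp: disjoint_pairs_iff finite_subset)
  have "card ({1..n} - (I \<union> J)) = n - card I - card J"
    using IJ by (simp add: card_Diff_subset card_Un_disjoint)
  then have "card {P. partition_on {1..n} P \<and> {I \<union> J} \<subseteq> P} = Bell (n - card I - card J)"
    using card_partitions_with_blocks[of "{1..n}" "I \<union> J" "{I \<union> J}"] IJ assms(3)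
    by (simp add: partition_on_space)
  moreover have "(\<Prod>x\<in>{1..n}. card (if x \<in> I then {\<alpha>} else {1..c} - {\<alpha>})) =
      (\<Prod>x\<in>{1..n}. if x \<in> I then 1 else if x \<in> {} then 1 else c - 1)"
    using assms(1) by (intro prod.cong) auto
  moreover have "\<dots> = (c - 1) ^ (n - card I)"
    using prod_disjoint_pairs[of "{1..n}" I "{}" 1 1 "c - 1"] IJ by (simp add: disjoint_pairs_iff)
  ultimately show ?thesis
    unfolding single_block_family_def by (simp add: card_cartesian_product card_PiE)
qed

section \<open>Size of a two-block family, computed over the four intervals cut out by
  \<open>i\<close>, \<open>j\<close>, \<open>k\<close>\<close>

lemma atLeastAtMost_minus_three:
  assumes "1 \<le> i" "i < j" "j < k" "k \<le> Suc n"
  shows "{1..n} - {i, j, k} = {1..<i} \<union> ({i<..<j} \<union> ({j<..<k} \<union> {k<..n}))"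
  using assms by auto

lemma partition_on_pair:
  assumes "U \<inter> V = {}" "U \<noteq> {}" "V \<noteq> {}"
  shows "partition_on (U \<union> V) {U, V}"
  using assms by (auto simp: partition_on_def disjoint_def)

text \<open>The pieces \<open>A\<close>, \<open>D\<close>, \<open>F\<close>, \<open>L\<close> of the
  block of \<open>i\<close> and \<open>B\<close>, \<open>E\<close>, \<open>G\<close>,
  \<open>M\<close> of the block of \<open>j\<close> lie in the four intervals. The numbers of
  colours are \<open>c - 1\<close> before \<open>i\<close> and after \<open>k\<close>; between
  \<open>i\<close> and \<open>j\<close>, \<open>c\<close> on \<open>D\<close> and
  \<open>c - 1\<close> elsewhere; between \<open>j\<close> and \<open>k\<close>, \<open>c\<close> on
  \<open>F \<union> G\<close> and \<open>c - 2\<close> elsewhere.\<close>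

lemma card_two_block_family:
  assumes "\<alpha> \<in> {1..c}" "\<beta> \<in> {1..c}" "\<alpha> \<noteq> \<beta>"
    and ijk: "1 \<le> i" "i < j" "j < k" "k \<le> Suc n"
    and AB: "(A, B) \<in> disjoint_pairs {1..<i}"
    and DE: "(D, E) \<in> disjoint_pairs {i<..<j}"
    and FG: "(F, G) \<in> disjoint_pairs {j<..<k}"
    and LM: "(L, M) \<in> disjoint_pairs {k<..n}"
  shows "card (two_block_family n c \<alpha> \<beta> i j k (A \<union> (D \<union> (F \<union> L))) (B \<union> (E \<union> (G \<union> M)))) =
    Bell (n - card A - card B - card D - card E - card F - card G - card L - card M - 2)
    * (c - 2) ^ (k - j - card F - card G - 1) * (c - 1) ^ (n - k + j - card D - 2)
    * c ^ (card D + card F + card G)"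
proof -
  let ?X = "A \<union> (D \<union> (F \<union> L))" and ?Y = "B \<union> (E \<union> (G \<union> M))"
  let ?K = "\<lambda>x. card (allowed_colors c \<alpha> \<beta> i j k ?X ?Y x)"
  have zones: "A \<subseteq> {1..<i}" "B \<subseteq> {1..<i}" "D \<subseteq> {i<..<j}" "E \<subseteq> {i<..<j}"
    "F \<subseteq> {j<..<k}" "G \<subseteq> {j<..<k}" "L \<subseteq> {k<..n}" "M \<subseteq> {k<..n}"
    and disj: "A \<inter> B = {}" "D \<inter> E = {}" "F \<inter> G = {}" "L \<inter> M = {}"
    using AB DE FG LM by (simp_all add: disjoint_pairs_iff)
  have separated: "{1..<i} \<inter> {i<..<j} = {}" "{1..<i} \<inter> {j<..<k} = {}" "{1..<i} \<inter> {k<..n} = {}"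
    "{i<..<j} \<inter> {j<..<k} = {}" "{i<..<j} \<inter> {k<..n} = {}" "{j<..<k} \<inter> {k<..n} = {}"
    using ijk by auto
  have fin: "finite A" "finite B" "finite D" "finite E" "finite F" "finite G" "finite L" "finite M"
    using zones by (auto intro: finite_subset)
  have X: "?X \<subseteq> {1..n} - {i, j, k}" and Y: "?Y \<subseteq> {1..n} - {i, j, k}"
    unfolding atLeastAtMost_minus_three[OF ijk] using zones by blast+
  \<comment> \<open>Pieces in different intervals are disjoint because the intervals are, pieces in
    the same interval by the choice of the pairs.\<close>
  have XY: "?X \<inter> ?Y = {}"
  proof -
    have "U \<inter> V = {}" if "U \<subseteq> S" "V \<subseteq> T" "S \<inter> T = {} \<or> T \<inter> S = {}" for U V S T :: "nat set"
      using that by blast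
    from this[OF zones(1,4)] this[OF zones(1,6)] this[OF zones(1,8)]
      this[OF zones(3,2)] this[OF zones(3,6)] this[OF zones(3,8)]
      this[OF zones(5,2)] this[OF zones(5,4)] this[OF zones(5,8)]
      this[OF zones(7,2)] this[OF zones(7,4)] this[OF zones(7,6)]
    show ?thesis
      using disj separated by (simp add: Int_Un_distrib Int_Un_distrib2)
  qed
  have cardX: "card ?X = card A + (card D + (card F + card L))"
  proof -
    have "A \<inter> (D \<union> (F \<union> L)) = {}" "D \<inter> (F \<union> L) = {}" "F \<inter> L = {}"
      using zones separated by blast+
    then show ?thesis using fin by (simp add: card_Un_disjoint)
  qed
  have cardY: "card ?Y = card B + (card E + (card G + card M))"
  proof -
    have "B \<inter> (E \<union> (G \<union> M)) = {}" "E \<inter> (G \<union> M) = {}" "G \<inter> M = {}"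
      using zones separated by blast+
    then show ?thesis using fin by (simp add: card_Un_disjoint)
  qed
  have new: "i \<notin> ?X" "i \<notin> ?Y" "j \<notin> ?X" "j \<notin> ?Y" "i \<noteq> j" "i \<in> {1..n}" "j \<in> {1..n}"
    using X Y ijk by auto
  have blocks: "insert i ?X \<inter> insert j ?Y = {}"
    using XY new by blast
  have "card (insert i ?X \<union> insert j ?Y) = Suc (card ?X) + Suc (card ?Y)"
    using blocks new fin by (simp only: card_Un_disjoint card_insert_disjoint finite_Un finite_insert simp_thms)
  moreover have sub: "insert i ?X \<union> insert j ?Y \<subseteq> {1..n}"
    using X Y new by blast
  ultimately have rest: "card ({1..n} - (insert i ?X \<union> insert j ?Y)) =
      n - card A - card B - card D - card E - card F - card G - card L - card M - 2"
    using fin cardX cardY by (subst card_Diff_subset) auto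
  have "partition_on (insert i ?X \<union> insert j ?Y) {insert i ?X, insert j ?Y}"
    using blocks by (rule partition_on_pair) (rule insert_not_empty)+
  from card_partitions_with_blocks[OF finite_atLeastAtMost this sub]
  have partitions: "card {P. partition_on {1..n} P \<and> {insert i ?X, insert j ?Y} \<subseteq> P} =
      Bell (n - card A - card B - card D - card E - card F - card G - card L - card M - 2)"
    unfolding rest .

  have bounds: "card D + card E \<le> j - i - 1" "card F + card G \<le> k - j - 1"
    using card_mono[of "{i<..<j}" "D \<union> E"] card_mono[of "{j<..<k}" "F \<union> G"] zones disj fin
    by (simp_all add: card_Un_disjoint)
  have card_C: "card ({1..c} - {\<alpha>}) = c - 1" "card ({1..c} - {\<beta>}) = c - 1"
    "card ({1..c} - {\<alpha>, \<beta>}) = c - 2"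
    using assms(1-3) by (simp_all add: card_Diff_subset)
  \<comment> \<open>The colour at \<open>i\<close>, \<open>j\<close>, \<open>k\<close> is forced, so
    these points contribute a factor 1.\<close>
  have "prod ?K {1..n} = prod ?K ({1..n} - {i, j, k})"
    by (rule prod.mono_neutral_right) (auto simp: allowed_colors_def)
  also have "\<dots> = prod ?K {1..<i} * (prod ?K {i<..<j} * (prod ?K {j<..<k} * prod ?K {k<..n}))"
  proof -
    have "{1..<i} \<inter> ({i<..<j} \<union> ({j<..<k} \<union> {k<..n})) = {}" "{i<..<j} \<inter> ({j<..<k} \<union> {k<..n}) = {}"
      using separated by auto
    then show ?thesis
      using separated(6)
      unfolding atLeastAtMost_minus_three[OF ijk]
      by (simp only: prod.union_disjoint finite_Un finite_atLeastLessThan finite_greaterThanLessThan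
          finite_greaterThanAtMost simp_thms)
  qed
  also have "prod ?K {1..<i} = (\<Prod>x\<in>{1..<i}. c - 1)"
    by (rule prod.cong) (use ijk card_C in \<open>auto simp: allowed_colors_def\<close>)
  also have "\<dots> = (c - 1) ^ (i - 1)"
    by simp
  \<comment> \<open>Membership in the block of \<open>j\<close> gives no extra colour before
    \<open>j\<close>; \<open>E\<close> is listed separately only to match the three-valued
    product.\<close>
  also have "prod ?K {i<..<j} = (\<Prod>x\<in>{i<..<j}. if x \<in> D then c else if x \<in> E then c - 1 else c - 1)"
  proof (rule prod.cong[OF refl])
    fix x assume x: "x \<in> {i<..<j}"
    then have "x \<in> ?X \<longleftrightarrow> x \<in> D"
      using zones separated by blast
    then show "?K x = (if x \<in> D then c else if x \<in> E then c - 1 else c - 1)"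
      using x ijk card_C by (simp add: allowed_colors_def)
  qed
  also have "\<dots> = c ^ card D * (c - 1) ^ card E * (c - 1) ^ (j - i - 1 - card D - card E)"
    by (subst prod_disjoint_pairs[OF _ DE]) simp_all
  also have "prod ?K {j<..<k} = (\<Prod>x\<in>{j<..<k}. if x \<in> F then c else if x \<in> G then c else c - 2)"
  proof (rule prod.cong[OF refl])
    fix x assume x: "x \<in> {j<..<k}"
    then have "x \<in> ?X \<union> ?Y \<longleftrightarrow> x \<in> F \<or> x \<in> G"
      using zones separated by blast
    then show "?K x = (if x \<in> F then c else if x \<in> G then c else c - 2)"
      using x ijk card_C by (simp add: allowed_colors_def)
  qed
  also have "\<dots> = c ^ card F * c ^ card G * (c - 2) ^ (k - j - 1 - card F - card G)"
    by (subst prod_disjoint_pairs[OF _ FG]) simp_all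
  also have "prod ?K {k<..n} = (\<Prod>x\<in>{k<..n}. c - 1)"
    by (rule prod.cong) (use ijk card_C in \<open>auto simp: allowed_colors_def\<close>)
  also have "\<dots> = (c - 1) ^ (n - k)"
    by simp
  finally have "prod ?K {1..n} = c ^ (card D + card F + card G) * (c - 2) ^ (k - j - 1 - card F - card G) *
      (c - 1) ^ ((i - 1) + card E + (j - i - 1 - card D - card E) + (n - k))"
    by (simp add: power_add mult.assoc mult.left_commute)
  \<comment> \<open>Factors \<open>c - 1\<close> come from \<open>i - 1\<close> elements before
    \<open>i\<close>, \<open>j - i - 1 - card D\<close> between \<open>i\<close> and
    \<open>j\<close>, and \<open>n - k\<close> after \<open>k\<close>. The bounds prevent truncated
    subtraction.\<close>
  moreover have "k - j - 1 - card F - card G = k - j - card F - card G - 1"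
    "(i - 1) + card E + (j - i - 1 - card D - card E) + (n - k) = n - k + j - card D - 2"
    using bounds ijk by auto
  ultimately have "prod ?K {1..n} = (c - 2) ^ (k - j - card F - card G - 1) *
      (c - 1) ^ (n - k + j - card D - 2) * c ^ (card D + card F + card G)"
    by (simp only: ac_simps)
  then show ?thesis
    unfolding two_block_family_def card_cartesian_product partitions
    by (simp only: card_PiE finite_atLeastAtMost mult.assoc)
qed

section \<open>Summing the family sizes over all choices of the blocks\<close>

text \<open>The size \<open>s\<close> is a separate variable so that the trinomials carry
  \<open>i - 1\<close> or \<open>j - i - 1\<close> instead of cardinalities. The pointwise premise
  allows nested application, one interval after the other.\<close>

lemma sum_disjoint_pairs_card_cong:
  fixes F :: "nat \<Rightarrow> nat \<Rightarrow> nat"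
  assumes "finite S" "card S \<le> N" "s = card S"
    and "\<And>X Y. (X, Y) \<in> disjoint_pairs S \<Longrightarrow> G X Y = F (card X) (card Y)"
  shows "(\<Sum>(X, Y)\<in>disjoint_pairs S. G X Y) = (\<Sum>a\<le>N. \<Sum>b\<le>N. trinomial s a b * F a b)"
proof -
  have "(\<Sum>(X, Y)\<in>disjoint_pairs S. G X Y) = (\<Sum>(X, Y)\<in>disjoint_pairs S. F (card X) (card Y))"
    by (rule sum.cong) (use assms(4) in auto)
  then show ?thesis
    using sum_disjoint_pairs_card[OF assms(1,2)] assms(3) by simp
qed

lemma card_disjoint_pair_le:
  assumes "(X, Y) \<in> disjoint_pairs S" "finite S"
  shows "card X + card Y \<le> card S"
proof -
  have "card X + card Y = card (X \<union> Y)"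
    using assms by (subst card_Un_disjoint) (auto simp: disjoint_pairs_iff finite_subset)
  also have "\<dots> \<le> card S"
    using assms by (intro card_mono) (auto simp: disjoint_pairs_iff)
  finally show ?thesis .
qed

lemma sum_disjoint_pairs_cong:
  assumes "\<And>X Y. (X, Y) \<in> disjoint_pairs S \<Longrightarrow> G X Y = H X Y"
  shows "(\<Sum>(X, Y)\<in>disjoint_pairs S. G X Y) = (\<Sum>(X, Y)\<in>disjoint_pairs S. H X Y)"
  by (rule sum.cong) (use assms in auto)

text \<open>Choosing the rest of the two blocks amounts to choosing a disjoint pair in each of the
  four intervals independently.\<close>

lemma sum_card_two_block_family:
  assumes "\<alpha> \<in> {1..c}" "\<beta> \<in> {1..c}" "\<alpha> \<noteq> \<beta>"
    and ijk: "1 \<le> i" "i < j" "j < k" "k \<le> Suc n"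
  shows "(\<Sum>(X, Y)\<in>disjoint_pairs ({1..n} - {i, j, k}). card (two_block_family n c \<alpha> \<beta> i j k X Y)) =
    (\<Sum>(A, B)\<in>disjoint_pairs {1..<i}. \<Sum>(D, E)\<in>disjoint_pairs {i<..<j}.
     \<Sum>(F, G)\<in>disjoint_pairs {j<..<k}. \<Sum>(L, M)\<in>disjoint_pairs {k<..n}.
      Bell (n - card A - card B - card D - card E - card F - card G - card L - card M - 2)
      * (c - 2) ^ (k - j - card F - card G - 1) * (c - 1) ^ (n - k + j - card D - 2)
      * c ^ (card D + card F + card G))"
proof -
  have "{1..<i} \<inter> ({i<..<j} \<union> ({j<..<k} \<union> {k<..n})) = {}"
    "{i<..<j} \<inter> ({j<..<k} \<union> {k<..n}) = {}" "{j<..<k} \<inter> {k<..n} = {}"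
    using ijk by auto
  note split = this[THEN sum_disjoint_pairs_Un]
  show ?thesis
    unfolding atLeastAtMost_minus_three[OF ijk] split
    by (intro sum_disjoint_pairs_cong) (rule card_two_block_family[OF assms])
qed

text \<open>With \<open>k = Suc n\<close> nothing lies after \<open>k\<close>, so there is no fourth
  trinomial. The exponents simplify because \<open>Suc n - j - f - g - 1 = n - j - f - g\<close> and
  \<open>n - Suc n = 0\<close>.\<close>

lemma sum_card_two_block_family_two:
  assumes "\<alpha> \<in> {1..c}" "\<beta> \<in> {1..c}" "\<alpha> \<noteq> \<beta>" and ij: "1 \<le> i" "i < j" "j \<le> n"
  shows "(\<Sum>(X, Y)\<in>disjoint_pairs ({1..n} - {i, j, Suc n}).
      card (two_block_family n c \<alpha> \<beta> i j (Suc n) X Y)) =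
    (\<Sum>a\<le>n. \<Sum>b\<le>n. \<Sum>d\<le>n. \<Sum>e\<le>n. \<Sum>f\<le>n. \<Sum>g\<le>n.
      trinomial (i - 1) a b * trinomial (j - i - 1) d e * trinomial (n - j) f g
      * Bell (n - a - b - d - e - f - g - 2)
      * (c - 2) ^ (n - j - f - g) * (c - 1) ^ (j - d - 2) * c ^ (d + f + g))"
    (is "_ = ?rhs")
proof -
  have "j < Suc n" "Suc n \<le> Suc n"
    using ij by auto
  note split = sum_card_two_block_family[OF assms(1-5) this]
  have "disjoint_pairs {Suc n<..n} = {({}, {})}"
    by (auto simp: disjoint_pairs_def)
  then have "(\<Sum>(X, Y)\<in>disjoint_pairs ({1..n} - {i, j, Suc n}).
      card (two_block_family n c \<alpha> \<beta> i j (Suc n) X Y)) =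
    (\<Sum>(A, B)\<in>disjoint_pairs {1..<i}. \<Sum>(D, E)\<in>disjoint_pairs {i<..<j}.
     \<Sum>(F, G)\<in>disjoint_pairs {j<..<Suc n}.
      Bell (n - card A - card B - card D - card E - card F - card G - 2)
      * (c - 2) ^ (n - j - card F - card G) * (c - 1) ^ (j - card D - 2)
      * c ^ (card D + card F + card G))"
    unfolding split using ij by (intro sum_disjoint_pairs_cong) (simp add: Suc_diff_le)
  also have "\<dots> = (\<Sum>a\<le>n. \<Sum>b\<le>n. trinomial (i - 1) a b *
      (\<Sum>d\<le>n. \<Sum>e\<le>n. trinomial (j - i - 1) d e * (\<Sum>f\<le>n. \<Sum>g\<le>n. trinomial (n - j) f g *
      (Bell (n - a - b - d - e - f - g - 2)
      * (c - 2) ^ (n - j - f - g) * (c - 1) ^ (j - d - 2) * c ^ (d + f + g)))))"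
    by (rule sum_disjoint_pairs_card_cong; (rule sum_disjoint_pairs_card_cong)?;
        (rule sum_disjoint_pairs_card_cong)?) (use ij in auto)
  also have "\<dots> = ?rhs"
    by (simp only: sum_distrib_left mult.assoc)
  finally show ?thesis .
qed

text \<open>Here \<open>k\<close> is an element left over by the first two blocks. Expanding the
  Bell number by the block of \<open>k\<close> produces the sum over \<open>p\<close>, the number of
  further elements in that block.\<close>

lemma sum_card_two_block_family_three:
  assumes "\<alpha> \<in> {1..c}" "\<beta> \<in> {1..c}" "\<alpha> \<noteq> \<beta>" and ijk: "1 \<le> i" "i < j" "j < k" "k \<le> n"
  shows "(\<Sum>(X, Y)\<in>disjoint_pairs ({1..n} - {i, j, k}).
      card (two_block_family n c \<alpha> \<beta> i j k X Y)) =
    (\<Sum>a\<le>n. \<Sum>b\<le>n. \<Sum>d\<le>n. \<Sum>e\<le>n. \<Sum>f\<le>n. \<Sum>g\<le>n. \<Sum>l\<le>n. \<Sum>m\<le>n. \<Sum>p\<le>n.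
      trinomial (i - 1) a b * trinomial (j - i - 1) d e * trinomial (k - j - 1) f g
      * trinomial (n - k) l m
      * ((n - a - b - d - e - f - g - l - m - 3) choose p)
      * Bell (n - a - b - d - e - f - g - l - m - p - 3)
      * (c - 2) ^ (k - j - f - g - 1) * (c - 1) ^ (n - k + j - d - 2) * c ^ (d + f + g))"
    (is "?lhs = ?rhs")
proof -
  have "k \<le> Suc n"
    using ijk by auto
  have Bell_expand: "Bell (n - card A - card B - card D - card E - card F - card G - card L - card M - 2) =
      (\<Sum>p\<le>n. ((n - card A - card B - card D - card E - card F - card G - card L - card M - 3) choose p) *
        Bell (n - card A - card B - card D - card E - card F - card G - card L - card M - p - 3))"
    if "(A, B) \<in> disjoint_pairs {1..<i}" "(D, E) \<in> disjoint_pairs {i<..<j}"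
      "(F, G) \<in> disjoint_pairs {j<..<k}" "(L, M) \<in> disjoint_pairs {k<..n}" for A B D E F G L M
  proof -
    define r where "r = n - card A - card B - card D - card E - card F - card G - card L - card M - 3"
    \<comment> \<open>The pieces have at most \<open>n - 3\<close> elements in all, so at least
      \<open>k\<close> is left over and the argument of \<open>Bell\<close> is a successor.\<close>
    have "n - card A - card B - card D - card E - card F - card G - card L - card M - 2 = Suc r"
      using that[THEN card_disjoint_pair_le] ijk unfolding r_def by simp
    moreover have "n - card A - card B - card D - card E - card F - card G - card L - card M - p - 3 =
        r - p" for p
      unfolding r_def by simp
    moreover have "r \<le> n"
      unfolding r_def by simp
    ultimately show ?thesis
      by (simp only: Bell_Suc r_def[symmetric])
  qed
  have "?lhs =
    (\<Sum>(A, B)\<in>disjoint_pairs {1..<i}. \<Sum>(D, E)\<in>disjoint_pairs {i<..<j}.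
     \<Sum>(F, G)\<in>disjoint_pairs {j<..<k}. \<Sum>(L, M)\<in>disjoint_pairs {k<..n}. \<Sum>p\<le>n.
      ((n - card A - card B - card D - card E - card F - card G - card L - card M - 3) choose p)
      * Bell (n - card A - card B - card D - card E - card F - card G - card L - card M - p - 3)
      * (c - 2) ^ (k - j - card F - card G - 1) * (c - 1) ^ (n - k + j - card D - 2)
      * c ^ (card D + card F + card G))"
    unfolding sum_card_two_block_family[OF assms(1-6) \<open>k \<le> Suc n\<close>]
    by (intro sum_disjoint_pairs_cong) (simp only: Bell_expand sum_distrib_right)
  also have "\<dots> = (\<Sum>a\<le>n. \<Sum>b\<le>n. trinomial (i - 1) a b *
      (\<Sum>d\<le>n. \<Sum>e\<le>n. trinomial (j - i - 1) d e * (\<Sum>f\<le>n. \<Sum>g\<le>n. trinomial (k - j - 1) f g *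
      (\<Sum>l\<le>n. \<Sum>m\<le>n. trinomial (n - k) l m * (\<Sum>p\<le>n.
      ((n - a - b - d - e - f - g - l - m - 3) choose p)
      * Bell (n - a - b - d - e - f - g - l - m - p - 3)
      * (c - 2) ^ (k - j - f - g - 1) * (c - 1) ^ (n - k + j - d - 2) * c ^ (d + f + g))))))"
    by (rule sum_disjoint_pairs_card_cong; (rule sum_disjoint_pairs_card_cong)?;
        (rule sum_disjoint_pairs_card_cong)?; (rule sum_disjoint_pairs_card_cong)?)
       ((rule refl | (use ijk in simp))+)
  also have "\<dots> = ?rhs"
    by (simp only: sum_distrib_left mult.assoc)
  finally show ?thesis .
qed

text \<open>The indices \<open>i\<close> and \<open>j\<close> are the sizes of \<open>I\<close> and
  \<open>J\<close>; the trinomial counting such pairs factors into the two binomials.\<close>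

lemma sum_card_single_block_family:
  assumes "\<alpha> \<in> {1..c}"
  shows "(\<Sum>(I, J)\<in>{(I, J) \<in> disjoint_pairs {1..n}. I \<noteq> {}}. card (single_block_family n c \<alpha> I J)) =
    (\<Sum>i=1..n. (n choose i) *
      (\<Sum>j=0..n-i. ((n - i) choose j) * Bell (n - i - j) * (c - 1) ^ (n - i)))"
proof -
  \<comment> \<open>The value 0 at \<open>a = 0\<close> encodes \<open>I \<noteq> {}\<close>, so the
    sum extends to all disjoint pairs.\<close>
  let ?F = "\<lambda>a b. if a = 0 then 0 else Bell (n - a - b) * (c - 1) ^ (n - a)"
  have "(\<Sum>(I, J)\<in>{(I, J) \<in> disjoint_pairs {1..n}. I \<noteq> {}}. card (single_block_family n c \<alpha> I J)) =
      (\<Sum>(I, J)\<in>disjoint_pairs {1..n}. ?F (card I) (card J))"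
  proof (rule sum.mono_neutral_cong_left)
    show "\<forall>p\<in>disjoint_pairs {1..n} - {(I, J) \<in> disjoint_pairs {1..n}. I \<noteq> {}}.
        (case p of (I, J) \<Rightarrow> ?F (card I) (card J)) = 0"
      by auto
    fix p assume p: "p \<in> {(I, J) \<in> disjoint_pairs {1..n}. I \<noteq> {}}"
    then obtain I J where IJ: "p = (I, J)" "(I, J) \<in> disjoint_pairs {1..n}" "I \<noteq> {}"
      by auto
    then have "card I \<noteq> 0"
      by (auto simp: disjoint_pairs_iff finite_subset[of I "{1..n}"])
    then show "(case p of (I, J) \<Rightarrow> card (single_block_family n c \<alpha> I J)) =
        (case p of (I, J) \<Rightarrow> ?F (card I) (card J))"
      using card_single_block_family[OF assms IJ(2,3)] IJ(1) by simp
  qed auto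
  also have "\<dots> = (\<Sum>a\<le>n. \<Sum>b\<le>n. trinomial n a b * ?F a b)"
    using sum_disjoint_pairs_card[of "{1..n}" n ?F] by simp
  also have "\<dots> = (\<Sum>a=1..n. \<Sum>b\<le>n. trinomial n a b * ?F a b)"
    by (rule sum.mono_neutral_right) auto
  also have "\<dots> = (\<Sum>i=1..n. (n choose i) *
      (\<Sum>j=0..n-i. ((n - i) choose j) * Bell (n - i - j) * (c - 1) ^ (n - i)))"
  proof (rule sum.cong[OF refl])
    fix a assume a: "a \<in> {1..n}"
    have "(\<Sum>b\<le>n. trinomial n a b * ?F a b) = (\<Sum>b=0..n-a. trinomial n a b * ?F a b)"
      by (rule sum.mono_neutral_right) (auto simp: trinomial_eq_choose binomial_eq_0)
    then show "(\<Sum>b\<le>n. trinomial n a b * ?F a b) =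
        (n choose a) * (\<Sum>j=0..n-a. ((n - a) choose j) * Bell (n - a - j) * (c - 1) ^ (n - a))"
      using a by (simp add: trinomial_eq_choose sum_distrib_left mult.assoc)
  qed
  finally show ?thesis .
qed

section \<open>Classification of the avoiders\<close>

text \<open>The \<alpha>-blocks are the blocks meeting this set; its containment in a single block
  expresses that there is at most one of them.\<close>

definition color_class :: "nat \<Rightarrow> nat \<Rightarrow> (nat \<Rightarrow> nat) \<Rightarrow> nat set" where
  "color_class n \<alpha> col = {x \<in> {1..n}. col x = \<alpha>}"

lemma eq_contains_aabI:
  assumes "X \<in> P" "Y \<in> P" "Z \<in> P" "X \<noteq> Y" "X \<noteq> Z" "Y \<noteq> Z" "x \<in> X" "y \<in> Y" "z \<in> Z"
    "x < y" "y < z" "col x = \<alpha>" "col y = \<alpha>" "col z = \<beta>"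
  shows "eq_contains_aab \<alpha> \<beta> (P, col)"
  unfolding eq_contains_aab_def prod.case
  by (rule bexI[of _ X], rule bexI[of _ Y], rule bexI[of _ Z], intro conjI,
      simp_all only: assms not_False_eq_True, rule bexI[of _ x], rule bexI[of _ y], rule bexI[of _ z])
     (simp_all add: assms)

text \<open>The pointwise colour sets force \<open>I\<close> to be the whole \<alpha>-class, so
  \<open>I\<close> can be recovered from the colouring.\<close>

lemma mem_single_block_family_iff:
  assumes "I \<subseteq> {1..n}" "\<alpha> \<in> {1..c}"
  shows "(P, col) \<in> single_block_family n c \<alpha> I J \<longleftrightarrow>
    partition_on {1..n} P \<and> col \<in> {1..n} \<rightarrow>\<^sub>E {1..c} \<and> I \<union> J \<in> P \<and> color_class n \<alpha> col = I"
proof -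
  have "col x \<in> (if x \<in> I then {\<alpha>} else {1..c} - {\<alpha>}) \<longleftrightarrow> col x \<in> {1..c} \<and> (col x = \<alpha> \<longleftrightarrow> x \<in> I)" for x
    using assms(2) by (cases "x \<in> I") auto
  moreover have "{x \<in> {1..n}. col x = \<alpha>} = I \<longleftrightarrow> (\<forall>x\<in>{1..n}. col x = \<alpha> \<longleftrightarrow> x \<in> I)"
    using assms(1) by blast
  ultimately have "col \<in> (\<Pi>\<^sub>E x\<in>{1..n}. if x \<in> I then {\<alpha>} else {1..c} - {\<alpha>}) \<longleftrightarrow>
      col \<in> {1..n} \<rightarrow>\<^sub>E {1..c} \<and> color_class n \<alpha> col = I"
    unfolding PiE_iff color_class_def by blast
  then show ?thesis
    unfolding single_block_family_def by (simp only: mem_Times_iff fst_conv snd_conv mem_Collect_eq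
        insert_subset empty_subsetI simp_thms conj_ac)
qed

text \<open>The colour sets are turned into statements about blocks: the conditions excluding
  \<alpha> make \<open>i\<close>, \<open>j\<close>, \<open>k\<close> the first elements of their
  kind, those excluding \<beta> rule out the pattern. Avoidance and uniqueness are derived from this
  form.\<close>

lemma two_block_familyD:
  assumes colors: "\<alpha> \<in> {1..c}" "\<alpha> \<noteq> \<beta>"
    and ijk: "1 \<le> i" "i < j" "j < k" "k \<le> Suc n"
    and mem: "(P, col) \<in> two_block_family n c \<alpha> \<beta> i j k X Y"
  shows "partition_on {1..n} P" "insert i X \<in> P" "insert j Y \<in> P" "col \<in> {1..n} \<rightarrow>\<^sub>E {1..c}"
    "col i = \<alpha>" "col j = \<alpha>" "k \<le> n \<Longrightarrow> col k = \<alpha>"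
    "\<And>x. x \<in> {1..n} \<Longrightarrow> x < i \<Longrightarrow> col x \<noteq> \<alpha>"
    "\<And>x. x \<in> {1..n} \<Longrightarrow> x < j \<Longrightarrow> x \<notin> insert i X \<Longrightarrow> col x \<noteq> \<alpha>"
    "\<And>x. x \<in> {1..n} \<Longrightarrow> x < k \<Longrightarrow> x \<notin> insert i X \<Longrightarrow> x \<notin> insert j Y \<Longrightarrow> col x \<noteq> \<alpha>"
    "\<And>x. x \<in> {1..n} \<Longrightarrow> j < x \<Longrightarrow> x \<notin> insert i X \<Longrightarrow> x \<notin> insert j Y \<Longrightarrow> col x \<noteq> \<beta>"
    "\<And>x. x \<in> {1..n} \<Longrightarrow> k < x \<Longrightarrow> col x \<noteq> \<beta>"
proof -
  show "partition_on {1..n} P" "insert i X \<in> P" "insert j Y \<in> P"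
    using mem by (simp_all add: two_block_family_def)
  have col: "col x \<in> allowed_colors c \<alpha> \<beta> i j k X Y x" if "x \<in> {1..n}" for x
    using that mem by (auto simp: two_block_family_def)
  have sub: "allowed_colors c \<alpha> \<beta> i j k X Y x \<subseteq> {1..c}" for x
    using colors by (auto simp: allowed_colors_def)
  have "(\<Pi>\<^sub>E x\<in>{1..n}. allowed_colors c \<alpha> \<beta> i j k X Y x) \<subseteq> {1..n} \<rightarrow>\<^sub>E {1..c}"
    by (intro PiE_mono sub)
  then show "col \<in> {1..n} \<rightarrow>\<^sub>E {1..c}"
    using mem by (auto simp: two_block_family_def)
  show "col i = \<alpha>" "col j = \<alpha>" "k \<le> n \<Longrightarrow> col k = \<alpha>"
    using col[of i] col[of j] col[of k] ijk by (auto simp: allowed_colors_def)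
  fix x assume x: "x \<in> {1..n}"
  note c = col[OF x, unfolded allowed_colors_def]
  show "x < i \<Longrightarrow> col x \<noteq> \<alpha>"
    using c ijk by auto
  show "x < j \<Longrightarrow> x \<notin> insert i X \<Longrightarrow> col x \<noteq> \<alpha>"
    using c ijk by (auto split: if_splits)
  show "x < k \<Longrightarrow> x \<notin> insert i X \<Longrightarrow> x \<notin> insert j Y \<Longrightarrow> col x \<noteq> \<alpha>"
    using c ijk by (auto split: if_splits)
  \<comment> \<open>At \<open>x = k\<close> the colour is \<alpha>, and
    \<open>\<alpha> \<noteq> \<beta>\<close> applies.\<close>
  show "j < x \<Longrightarrow> x \<notin> insert i X \<Longrightarrow> x \<notin> insert j Y \<Longrightarrow> col x \<noteq> \<beta>"
    using c ijk colors by (auto split: if_splits)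
  show "k < x \<Longrightarrow> col x \<noteq> \<beta>"
    using c ijk by auto
qed

lemma two_block_familyI:
  assumes ijk: "1 \<le> i" "i < j" "j < k" "k \<le> Suc n"
    and "partition_on {1..n} P" "insert i X \<in> P" "insert j Y \<in> P" "col \<in> {1..n} \<rightarrow>\<^sub>E {1..c}"
    "col i = \<alpha>" "col j = \<alpha>" "k \<le> n \<Longrightarrow> col k = \<alpha>"
    "\<And>x. x \<in> {1..n} \<Longrightarrow> x < i \<Longrightarrow> col x \<noteq> \<alpha>"
    "\<And>x. x \<in> {1..n} \<Longrightarrow> x < j \<Longrightarrow> x \<notin> insert i X \<Longrightarrow> col x \<noteq> \<alpha>"
    "\<And>x. x \<in> {1..n} \<Longrightarrow> x < k \<Longrightarrow> x \<notin> insert i X \<Longrightarrow> x \<notin> insert j Y \<Longrightarrow> col x \<noteq> \<alpha>"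
    "\<And>x. x \<in> {1..n} \<Longrightarrow> j < x \<Longrightarrow> x \<notin> insert i X \<Longrightarrow> x \<notin> insert j Y \<Longrightarrow> col x \<noteq> \<beta>"
    "\<And>x. x \<in> {1..n} \<Longrightarrow> k < x \<Longrightarrow> col x \<noteq> \<beta>"
  shows "(P, col) \<in> two_block_family n c \<alpha> \<beta> i j k X Y"
proof -
  have "col x \<in> allowed_colors c \<alpha> \<beta> i j k X Y x" if x: "x \<in> {1..n}" for x
  proof -
    have "col x \<in> {1..c}"
      using assms(8) x by blast
    moreover have "x \<in> {i, j, k} \<Longrightarrow> col x = \<alpha>"
      using assms(9-11) x by auto
    ultimately show ?thesis
      using assms(12-16)[OF x] ijk by (auto simp: allowed_colors_def)
  qed
  then show ?thesis
    using assms(5-8) by (simp add: two_block_family_def PiE_iff)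
qed

section \<open>Covering of the avoiders by the families and uniqueness of the parameters\<close>

text \<open>The pattern needs elements coloured \<alpha> in two different blocks, so a single
  \<alpha>-block excludes it. Conversely, \<open>I\<close> is taken as the \<alpha>-class and
  \<open>J\<close> as the rest of its block.\<close>

lemma eq_avoiders_one_block:
  assumes "\<alpha> \<in> {1..c}"
  shows "{(P, col) \<in> eq_avoiders_aab n c \<alpha> \<beta>.
      color_class n \<alpha> col \<noteq> {} \<and> (\<exists>X\<in>P. color_class n \<alpha> col \<subseteq> X)} =
    (\<Union>(I, J)\<in>{(I, J) \<in> disjoint_pairs {1..n}. I \<noteq> {}}. single_block_family n c \<alpha> I J)"
    (is "?L = ?R")
proof (intro set_eqI iffI)
  fix q assume q: "q \<in> ?L"
  obtain P col where Pcol: "q = (P, col)" by fastforce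
  then obtain X where X: "X \<in> P" "color_class n \<alpha> col \<subseteq> X" and
    P: "partition_on {1..n} P" "col \<in> {1..n} \<rightarrow>\<^sub>E {1..c}" "color_class n \<alpha> col \<noteq> {}"
    using q by (auto simp: eq_avoiders_aab_def colored_partitions_def)
  let ?I = "color_class n \<alpha> col" and ?J = "X - color_class n \<alpha> col"
  have "X \<subseteq> {1..n}"
    using P X by (auto simp: partition_on_def)
  then have "(?I, ?J) \<in> disjoint_pairs {1..n}"
    using X by (auto simp: disjoint_pairs_iff)
  moreover have "?I \<subseteq> {1..n}" "?I \<union> ?J = X"
    using X by (auto simp: color_class_def)
  then have "(P, col) \<in> single_block_family n c \<alpha> ?I ?J"
    using mem_single_block_family_iff[OF \<open>?I \<subseteq> {1..n}\<close> assms] P X by simp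
  ultimately show "q \<in> ?R"
    using P(3) Pcol by blast
next
  fix q assume q: "q \<in> ?R"
  then obtain I J where IJ: "(I, J) \<in> disjoint_pairs {1..n}" "I \<noteq> {}"
    "q \<in> single_block_family n c \<alpha> I J" by blast
  obtain P col where Pcol: "q = (P, col)" by fastforce
  have I: "I \<subseteq> {1..n}"
    using IJ by (simp add: disjoint_pairs_iff)
  have P: "partition_on {1..n} P" "col \<in> {1..n} \<rightarrow>\<^sub>E {1..c}" "I \<union> J \<in> P" "color_class n \<alpha> col = I"
    using mem_single_block_family_iff[OF I assms] IJ(3) Pcol by auto
  have "\<not> eq_contains_aab \<alpha> \<beta> (P, col)"
  proof
    assume "eq_contains_aab \<alpha> \<beta> (P, col)"
    then obtain X Y x y where xy: "X \<in> P" "Y \<in> P" "X \<noteq> Y" "x \<in> X" "y \<in> Y" "col x = \<alpha>" "col y = \<alpha>"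
      unfolding eq_contains_aab_def by auto
    then have "x \<in> I" "y \<in> I"
      using P partition_onD1[OF P(1)] by (auto simp: color_class_def)
    then have "X = I \<union> J" "Y = I \<union> J"
      using partition_on_unique_block[OF P(1)] xy P(3) by blast+
    then show False
      using xy by simp
  qed
  then show "q \<in> ?L"
    using P IJ(2) Pcol by (auto simp: eq_avoiders_aab_def colored_partitions_def)
qed

text \<open>In an occurrence \<open>x < y < z\<close>, the colour \<beta> at \<open>z\<close> forces
  \<open>z < k\<close>, hence \<open>x\<close> and \<open>y\<close> lie in the two blocks, one in
  each. The one in the block of \<open>j\<close> is not before \<open>j\<close>, so \<open>z\<close>
  comes after \<open>j\<close> in a third block, where \<beta> is excluded.\<close>

lemma two_block_family_avoids:
  assumes colors: "\<alpha> \<in> {1..c}" "\<alpha> \<noteq> \<beta>"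
    and ijk: "1 \<le> i" "i < j" "j < k" "k \<le> Suc n"
    and XY: "(X, Y) \<in> disjoint_pairs ({1..n} - {i, j, k})"
    and mem: "(P, col) \<in> two_block_family n c \<alpha> \<beta> i j k X Y"
  shows "(P, col) \<in> eq_avoiders_aab n c \<alpha> \<beta>" "\<not> (\<exists>Z\<in>P. color_class n \<alpha> col \<subseteq> Z)"
proof -
  note spec = two_block_familyD[OF colors ijk mem]
  note P = spec(1-3)
  note same = partition_on_unique_block[OF P(1)]
  have neq: "insert i X \<inter> insert j Y = {}"
    using XY ijk by (auto simp: disjoint_pairs_iff)
  have "\<not> eq_contains_aab \<alpha> \<beta> (P, col)"
  proof
    assume "eq_contains_aab \<alpha> \<beta> (P, col)"
    then obtain U V W where UVW: "U \<in> P" "V \<in> P" "W \<in> P" "U \<noteq> V" "U \<noteq> W" "V \<noteq> W"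
      "\<exists>x\<in>U. \<exists>y\<in>V. \<exists>z\<in>W. x < y \<and> y < z \<and> col x = \<alpha> \<and> col y = \<alpha> \<and> col z = \<beta>"
      unfolding eq_contains_aab_def by blast
    then obtain x y z where xyz: "x < y" "y < z" "col x = \<alpha>" "col y = \<alpha>" "col z = \<beta>"
      and in_blocks: "x \<in> U" "y \<in> V" "z \<in> W"
      by blast
    have N: "x \<in> {1..n}" "y \<in> {1..n}" "z \<in> {1..n}"
      using UVW(1-3) in_blocks partition_onD1[OF P(1)] by blast+
    have "\<not> k < z"
      using spec(12)[OF N(3)] xyz by blast
    moreover have "z \<noteq> k"
      using spec(7) N(3) xyz colors by auto
    ultimately have "x < k" "y < k"
      using xyz by auto
    then have "x \<in> insert i X \<union> insert j Y" "y \<in> insert i X \<union> insert j Y"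
      using spec(10)[OF N(1)] spec(10)[OF N(2)] xyz by blast+
    then have "U = insert i X \<or> U = insert j Y" "V = insert i X \<or> V = insert j Y"
      using same[OF UVW(1) P(2) in_blocks(1)] same[OF UVW(1) P(3) in_blocks(1)]
        same[OF UVW(2) P(2) in_blocks(2)] same[OF UVW(2) P(3) in_blocks(2)] by (metis UnE)+
    then have UV: "U = insert i X \<and> V = insert j Y \<or> U = insert j Y \<and> V = insert i X"
      using UVW(4) by metis
    \<comment> \<open>Before \<open>j\<close> the colour \<alpha> occurs only in the block of
      \<open>i\<close>, which is disjoint from that of \<open>j\<close>.\<close>
    have late: "j \<le> v" if "v \<in> insert j Y" "v \<in> {1..n}" "col v = \<alpha>" for v
    proof (rule ccontr)
      assume "\<not> j \<le> v"
      moreover have "v \<notin> insert i X"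
        using that(1) neq by blast
      ultimately show False
        using spec(9)[OF that(2)] that(3) by simp
    qed
    have "j < z"
    proof -
      have "j \<le> x \<or> j \<le> y"
        using UV late N(1,2) xyz(3,4) in_blocks(1,2) by blast
      then show ?thesis
        using xyz(1,2) by linarith
    qed
    moreover have "z \<notin> insert i X \<union> insert j Y"
      using UV UVW(5,6) same[OF UVW(3) P(2) in_blocks(3)] same[OF UVW(3) P(3) in_blocks(3)]
      by (metis UnE)
    ultimately show False
      using spec(11)[OF N(3)] xyz by blast
  qed
  then show "(P, col) \<in> eq_avoiders_aab n c \<alpha> \<beta>"
    using spec(1,4) by (simp add: eq_avoiders_aab_def colored_partitions_def)
  show "\<not> (\<exists>Z\<in>P. color_class n \<alpha> col \<subseteq> Z)"
  proof
    assume "\<exists>Z\<in>P. color_class n \<alpha> col \<subseteq> Z"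
    then obtain Z where "Z \<in> P" "color_class n \<alpha> col \<subseteq> Z" by blast
    moreover have "i \<in> color_class n \<alpha> col" "j \<in> color_class n \<alpha> col"
      using spec(5,6) ijk by (auto simp: color_class_def)
    ultimately have "insert i X = Z" "insert j Y = Z"
      using same P by blast+
    then show False
      using neq by blast
  qed
qed

text \<open>Successive minima serve as \<open>i\<close>, \<open>j\<close>, \<open>k\<close>: of the
  \<alpha>-class, of its part outside the block of \<open>i\<close>, and of its part outside both
  blocks. A forbidden \<beta> would complete the pattern with two of these elements.\<close>

lemma two_block_family_exists:
  assumes colors: "\<alpha> \<in> {1..c}" "\<alpha> \<noteq> \<beta>"
    and mem: "(P, col) \<in> eq_avoiders_aab n c \<alpha> \<beta>"
    and spread: "\<not> (\<exists>Z\<in>P. color_class n \<alpha> col \<subseteq> Z)" and "P \<noteq> {}"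
  shows "\<exists>i j k X Y. 1 \<le> i \<and> i < j \<and> j < k \<and> k \<le> Suc n \<and>
    (X, Y) \<in> disjoint_pairs ({1..n} - {i, j, k}) \<and>
    (P, col) \<in> two_block_family n c \<alpha> \<beta> i j k X Y"
proof -
  let ?V = "color_class n \<alpha> col"
  have P: "partition_on {1..n} P" and col: "col \<in> {1..n} \<rightarrow>\<^sub>E {1..c}"
    and avoid: "\<not> eq_contains_aab \<alpha> \<beta> (P, col)"
    using mem by (auto simp: eq_avoiders_aab_def colored_partitions_def)
  note same = partition_on_unique_block[OF P]
  have block: "\<exists>Z\<in>P. x \<in> Z" if "x \<in> {1..n}" for x
    using that partition_onD1[OF P] by blast
  have V: "x \<in> ?V \<longleftrightarrow> x \<in> {1..n} \<and> col x = \<alpha>" for x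
    by (auto simp: color_class_def)
  have least: "\<exists>x\<in>S. \<forall>y\<in>S. x \<le> y" if "S \<noteq> {}" for S :: "nat set"
  proof -
    from that obtain x where "x \<in> S"
      by blast
    then show ?thesis
      by (intro bexI[of _ "LEAST x. x \<in> S"]) (auto intro: LeastI Least_le)
  qed
  \<comment> \<open>An empty class would be contained in any block, and \<open>P \<noteq> {}\<close>
    supplies one.\<close>
  have "?V \<noteq> {}"
    using spread \<open>P \<noteq> {}\<close> by blast
  from least[OF this] obtain i where i: "i \<in> ?V" "\<And>x. x \<in> ?V \<Longrightarrow> i \<le> x"
    by blast
  obtain X where X: "X \<in> P" "i \<in> X"
    using block i(1) V by blast
  have "?V - X \<noteq> {}"
    using spread X by blast
  from least[OF this] obtain j where j: "j \<in> ?V" "j \<notin> X" "\<And>x. x \<in> ?V \<Longrightarrow> x \<notin> X \<Longrightarrow> j \<le> x"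
    by blast
  obtain Y where Y: "Y \<in> P" "j \<in> Y"
    using block j(1) V by blast
  have "X \<noteq> Y"
    using j Y by blast
  have XY: "X \<inter> Y = {}"
    using same X Y \<open>X \<noteq> Y\<close> by blast
  have "i < j"
    using i(2)[OF j(1)] j(2) X(2) by (cases "i = j") auto
  \<comment> \<open>If the two blocks cover the class, the value \<open>Suc n\<close> is taken; it
    lies outside \<open>{1..n}\<close> and so outside both blocks.\<close>
  obtain k where k: "k \<le> Suc n" "k \<le> n \<Longrightarrow> k \<in> ?V" "k \<notin> X \<union> Y"
    "\<And>x. x \<in> ?V \<Longrightarrow> x \<notin> X \<union> Y \<Longrightarrow> k \<le> x"
  proof (cases "?V - (X \<union> Y) = {}")
    case True
    have "Suc n \<notin> X \<union> Y"
    proof -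
      have "X \<union> Y \<subseteq> {1..n}"
        using partition_onD1[OF P] X(1) Y(1) by blast
      then show ?thesis by auto
    qed
    then show ?thesis
      using that[of "Suc n"] True by (metis DiffI empty_iff not_less_eq_eq order_refl)
  next
    case False
    from least[OF this] obtain k where "k \<in> ?V - (X \<union> Y)" "\<forall>y\<in>?V - (X \<union> Y). k \<le> y"
      by blast
    moreover from this have "k \<le> Suc n"
      using V by simp
    ultimately show ?thesis
      using that[of k] by blast
  qed
  have "j < k"
  proof (cases "k \<le> n")
    case True
    then show ?thesis
      using j(3)[OF k(2)] k(3) Y(2) by (cases "j = k") auto
  next
    case False
    then show ?thesis
      using j(1) V by auto
  qed
  \<comment> \<open>Distinctness of the blocks is phrased as the absence of a common block, so that
    applications need not name the blocks.\<close>
  have no_\<beta>: "col z \<noteq> \<beta>"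
    if xyz: "x \<in> ?V" "y \<in> ?V" "z \<in> {1..n}" "x < y" "y < z"
      "\<And>Z. Z \<in> P \<Longrightarrow> x \<in> Z \<Longrightarrow> y \<in> Z \<Longrightarrow> False" "\<And>Z. Z \<in> P \<Longrightarrow> x \<in> Z \<Longrightarrow> z \<in> Z \<Longrightarrow> False"
      "\<And>Z. Z \<in> P \<Longrightarrow> y \<in> Z \<Longrightarrow> z \<in> Z \<Longrightarrow> False" for x y z
  proof
    assume "col z = \<beta>"
    obtain A where A: "A \<in> P" "x \<in> A"
      using block[of x] xyz(1) V by blast
    obtain B where B: "B \<in> P" "y \<in> B"
      using block[of y] xyz(2) V by blast
    obtain C where C: "C \<in> P" "z \<in> C"
      using block[OF xyz(3)] by blast
    have "A \<noteq> B" "A \<noteq> C" "B \<noteq> C"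
      using xyz(6-8) A B C by blast+
    then have "eq_contains_aab \<alpha> \<beta> (P, col)"
      using A B C xyz(1,2,4,5) V \<open>col z = \<beta>\<close> by (intro eq_contains_aabI[of A P B C x y z]) simp_all
    then show False
      using avoid by simp
  qed
  have inX: "Z = X" if "Z \<in> P" "i \<in> Z" for Z
    using same that X by blast
  have inY: "Z = Y" if "Z \<in> P" "j \<in> Z" for Z
    using same that Y by blast
  have between: "col x \<noteq> \<beta>" if "x \<in> {1..n}" "j < x" "x \<notin> X" "x \<notin> Y" for x
    using no_\<beta>[OF i(1) j(1) that(1) \<open>i < j\<close> that(2)] inX inY j(2) that(3,4) by blast
  \<comment> \<open>The pair completing the pattern depends on the block of \<open>x\<close>:
    \<open>j\<close> and \<open>k\<close> for \<open>X\<close>, \<open>i\<close> and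
    \<open>k\<close> for \<open>Y\<close>, and \<open>i\<close> and \<open>j\<close>
    otherwise.\<close>
  have after: "col x \<noteq> \<beta>" if x: "x \<in> {1..n}" "k < x" for x
  proof -
    have kV: "k \<in> ?V" and "i < k"
      using k(2) x \<open>i < j\<close> \<open>j < k\<close> by auto
    show ?thesis
    proof (cases "x \<in> X")
      case True
      then have "Z = X" if "Z \<in> P" "x \<in> Z" for Z
        using same that X by blast
      then show ?thesis
        using no_\<beta>[OF j(1) kV x(1) \<open>j < k\<close> x(2)] inY j(2) k(3) by blast
    next
      case False
      show ?thesis
      proof (cases "x \<in> Y")
        case True
        then have "Z = Y" if "Z \<in> P" "x \<in> Z" for Z
          using same that Y by blast
        then show ?thesis
          using no_\<beta>[OF i(1) kV x(1) \<open>i < k\<close> x(2)] inX k(3) X XY by blast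
      next
        case False
        then show ?thesis
          using between[OF x(1)] \<open>x \<notin> X\<close> x(2) \<open>j < k\<close> by simp
      qed
    qed
  qed
  have XYi: "insert i (X - {i}) = X" "insert j (Y - {j}) = Y"
    using X Y by auto
  have "X \<subseteq> {1..n}" "Y \<subseteq> {1..n}"
    using X Y partition_onD1[OF P] by blast+
  moreover have "i \<notin> Y"
    using X(2) XY by blast
  ultimately have "(X - {i}, Y - {j}) \<in> disjoint_pairs ({1..n} - {i, j, k})"
    using XY j(2) k(3) unfolding disjoint_pairs_iff by blast
  moreover have "1 \<le> i"
    using i(1) V by simp
  moreover have "(P, col) \<in> two_block_family n c \<alpha> \<beta> i j k (X - {i}) (Y - {j})"
  proof (rule two_block_familyI[OF \<open>1 \<le> i\<close> \<open>i < j\<close> \<open>j < k\<close> k(1) P], unfold XYi)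
    show "col i = \<alpha>" "col j = \<alpha>" "k \<le> n \<Longrightarrow> col k = \<alpha>"
      using i(1) j(1) k(2) V by auto
    fix x assume x: "x \<in> {1..n}"
    show "x < i \<Longrightarrow> col x \<noteq> \<alpha>" "x < j \<Longrightarrow> x \<notin> X \<Longrightarrow> col x \<noteq> \<alpha>"
      "x < k \<Longrightarrow> x \<notin> X \<Longrightarrow> x \<notin> Y \<Longrightarrow> col x \<noteq> \<alpha>"
      using i(2)[of x] j(3)[of x] k(4)[of x] V x by auto
  qed (use X Y col between after in auto)
  ultimately show ?thesis
    using \<open>i < j\<close> \<open>j < k\<close> k(1) by blast
qed

text \<open>The parameters are read off one after another: the first \<alpha> is \<open>i\<close>,
  its block gives \<open>X\<close>; the first \<alpha> outside it is \<open>j\<close>, whose block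
  gives \<open>Y\<close>; then \<open>k\<close> is determined.\<close>

lemma two_block_family_unique:
  assumes colors: "\<alpha> \<in> {1..c}" "\<alpha> \<noteq> \<beta>"
    and ijk: "1 \<le> i" "i < j" "j < k" "k \<le> Suc n"
      "(X, Y) \<in> disjoint_pairs ({1..n} - {i, j, k})"
      "(P, col) \<in> two_block_family n c \<alpha> \<beta> i j k X Y"
    and ijk': "1 \<le> i'" "i' < j'" "j' < k'" "k' \<le> Suc n"
      "(X', Y') \<in> disjoint_pairs ({1..n} - {i', j', k'})"
      "(P, col) \<in> two_block_family n c \<alpha> \<beta> i' j' k' X' Y'"
  shows "i = i' \<and> j = j' \<and> k = k' \<and> X = X' \<and> Y = Y'"
proof -
  note s = two_block_familyD[OF colors ijk(1-4,6)]
  note s' = two_block_familyD[OF colors ijk'(1-4,6)]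
  note same = partition_on_unique_block[OF s(1)]
  have fresh: "i \<notin> X" "j \<notin> Y" "i' \<notin> X'" "j' \<notin> Y'" "j \<notin> insert i X" "j' \<notin> insert i' X'"
    "k \<notin> insert i X \<union> insert j Y" "k' \<notin> insert i' X' \<union> insert j' Y'"
    using ijk ijk' by (auto simp: disjoint_pairs_iff)
  have N: "i \<in> {1..n}" "i' \<in> {1..n}" "j \<in> {1..n}" "j' \<in> {1..n}"
    using ijk ijk' by auto
  have "\<not> i < i'" "\<not> i' < i"
    using s'(8)[OF N(1)] s(8)[OF N(2)] s(5) s'(5) by blast+
  then have i: "i = i'" by simp
  then have X1: "insert i X = insert i' X'"
    using same[of "insert i X" "insert i' X'" i] s(2) s'(2) i by blast
  have "\<not> j < j'"
    using s'(9)[OF N(3)] s(6) fresh(5) X1 by blast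
  moreover have "\<not> j' < j"
    using s(9)[OF N(4)] s'(6) fresh(6) X1 by blast
  ultimately have j: "j = j'" by simp
  then have Y1: "insert j Y = insert j' Y'"
    using same[of "insert j Y" "insert j' Y'" j] s(3) s'(3) j by blast
  \<comment> \<open>Since \<open>k' \<le> Suc n\<close>, the assumption yields
    \<open>k \<le> n\<close>, so \<open>k\<close> really is coloured \<alpha> and contradicts the
    minimality of \<open>k'\<close>.\<close>
  have "\<not> k < k'"
  proof
    assume "k < k'"
    then have "k \<in> {1..n}" "col k = \<alpha>"
      using ijk(1-4) ijk'(4) s(7) by auto
    then show False
      using s'(10)[of k] \<open>k < k'\<close> fresh(7) X1 Y1 by blast
  qed
  moreover have "\<not> k' < k"
  proof
    assume "k' < k"
    then have "k' \<in> {1..n}" "col k' = \<alpha>"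
      using ijk(4) ijk'(1-4) s'(7) by auto
    then show False
      using s(10)[of k'] \<open>k' < k\<close> fresh(8) X1 Y1 by blast
  qed
  ultimately have "k = k'" by simp
  then show ?thesis
    using i j X1 Y1 fresh by (metis insert_ident)
qed

section \<open>Counting the avoiders by their number of \<alpha>-blocks\<close>

lemma finite_eq_avoiders: "finite (eq_avoiders_aab n c \<alpha> \<beta>)"
proof -
  have "finite (colored_partitions n c)"
    unfolding colored_partitions_def
    by (intro finite_cartesian_product finite_PiE finitely_many_partition_on) auto
  then show ?thesis
    by (auto simp: eq_avoiders_aab_def)
qed

text \<open>Without an element coloured \<alpha> the pattern cannot occur, so the partition is
  arbitrary and each element has \<open>c - 1\<close> colours.\<close>

lemma card_avoiders_no_block:
  assumes "\<alpha> \<in> {1..c}"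
  shows "card {(P, col) \<in> eq_avoiders_aab n c \<alpha> \<beta>. color_class n \<alpha> col = {}} =
    Bell n * (c - 1) ^ n"
proof -
  have "{(P, col) \<in> eq_avoiders_aab n c \<alpha> \<beta>. color_class n \<alpha> col = {}} =
      {P. partition_on {1..n} P} \<times> ({1..n} \<rightarrow>\<^sub>E {1..c} - {\<alpha>})" (is "?L = ?R")
  proof -
    have colorings: "col \<in> {1..n} \<rightarrow>\<^sub>E {1..c} - {\<alpha>} \<longleftrightarrow>
        col \<in> {1..n} \<rightarrow>\<^sub>E {1..c} \<and> color_class n \<alpha> col = {}" for col
      unfolding PiE_iff color_class_def by blast
    have avoids: "\<not> eq_contains_aab \<alpha> \<beta> (P, col)"
      if "partition_on {1..n} P" "color_class n \<alpha> col = {}" for P col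
      using that partition_onD1[OF that(1)] unfolding eq_contains_aab_def color_class_def by blast
    show ?thesis
    proof (rule set_eqI)
      fix q :: "nat set set \<times> (nat \<Rightarrow> nat)"
      obtain P col where Pcol: "q = (P, col)" by fastforce
      show "q \<in> ?L \<longleftrightarrow> q \<in> ?R"
        unfolding Pcol eq_avoiders_aab_def colored_partitions_def mem_Collect_eq prod.case
          mem_Times_iff fst_conv snd_conv colorings
        using avoids[of P col] by blast
    qed
  qed
  then show ?thesis
    using assms by (simp add: card_cartesian_product card_PiE card_partitions_eq_Bell)
qed

text \<open>The families are pairwise disjoint, since \<open>I\<close> is recovered as the
  \<alpha>-class and \<open>J\<close> as the rest of the block containing it; hence their sizes add
  up.\<close>

lemma card_avoiders_one_block:
  assumes "\<alpha> \<in> {1..c}"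
  shows "card {(P, col) \<in> eq_avoiders_aab n c \<alpha> \<beta>.
      color_class n \<alpha> col \<noteq> {} \<and> (\<exists>X\<in>P. color_class n \<alpha> col \<subseteq> X)} =
    (\<Sum>i=1..n. (n choose i) *
      (\<Sum>j=0..n-i. ((n - i) choose j) * Bell (n - i - j) * (c - 1) ^ (n - i)))"
proof -
  let ?T = "{(I, J) \<in> disjoint_pairs {1..n}. I \<noteq> {}}"
  have "card (\<Union>p\<in>?T. case p of (I, J) \<Rightarrow> single_block_family n c \<alpha> I J) =
      (\<Sum>p\<in>?T. card (case p of (I, J) \<Rightarrow> single_block_family n c \<alpha> I J))"
  proof (rule card_UN_disjoint)
    show "finite ?T"
      by (rule finite_subset[of _ "disjoint_pairs {1..n}"]) auto
    show "\<forall>p\<in>?T. finite (case p of (I, J) \<Rightarrow> single_block_family n c \<alpha> I J)"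
      by (auto simp: finite_single_block_family)
    show "\<forall>p\<in>?T. \<forall>p'\<in>?T. p \<noteq> p' \<longrightarrow> (case p of (I, J) \<Rightarrow> single_block_family n c \<alpha> I J) \<inter>
        (case p' of (I, J) \<Rightarrow> single_block_family n c \<alpha> I J) = {}"
    proof (intro ballI impI equals0I)
      fix p p' q assume p: "p \<in> ?T" "p' \<in> ?T" "p \<noteq> p'"
        and q: "q \<in> (case p of (I, J) \<Rightarrow> single_block_family n c \<alpha> I J) \<inter>
        (case p' of (I, J) \<Rightarrow> single_block_family n c \<alpha> I J)"
      obtain I J I' J' P col where [simp]: "p = (I, J)" "p' = (I', J')" "q = (P, col)"
        by (metis surj_pair)
      have IJ: "I \<subseteq> {1..n}" "I' \<subseteq> {1..n}" "I \<inter> J = {}" "I' \<inter> J' = {}" "I \<noteq> {}"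
        using p by (auto simp: disjoint_pairs_iff)
      have P: "partition_on {1..n} P" "I \<union> J \<in> P" "I' \<union> J' \<in> P" "I = I'"
        using q mem_single_block_family_iff[OF IJ(1) assms] mem_single_block_family_iff[OF IJ(2) assms]
        by auto
      obtain x where "x \<in> I" using IJ(5) by blast
      then have "I \<union> J = I' \<union> J'"
        using partition_on_unique_block[OF P(1-3), of x] P(4) by blast
      then have "J = J'"
        using IJ(3,4) P(4) by blast
      then show False
        using p P(4) by simp
    qed
  qed
  then show ?thesis
    unfolding eq_avoiders_one_block[OF assms] sum_card_single_block_family[OF assms, symmetric]
    by (simp add: case_prod_unfold)
qed

text \<open>Allowing \<open>k \<le> Suc n\<close> treats two and more \<alpha>-blocks together.
  Existence of the parameters gives a cover by the families, uniqueness makes it disjoint.\<close>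

lemma card_avoiders_several_blocks:
  assumes colors: "\<alpha> \<in> {1..c}" "\<beta> \<in> {1..c}" "\<alpha> \<noteq> \<beta>" and "n \<ge> 1"
  shows "card {(P, col) \<in> eq_avoiders_aab n c \<alpha> \<beta>. \<not> (\<exists>X\<in>P. color_class n \<alpha> col \<subseteq> X)} =
    (\<Sum>(i, j, k)\<in>{(i, j, k). 1 \<le> i \<and> i < j \<and> j < k \<and> k \<le> Suc n}.
      \<Sum>(X, Y)\<in>disjoint_pairs ({1..n} - {i, j, k}). card (two_block_family n c \<alpha> \<beta> i j k X Y))"
proof -
  let ?I = "{(i, j, k). 1 \<le> i \<and> i < j \<and> j < k \<and> k \<le> Suc n}"
  let ?D = "\<lambda>(i, j, k). disjoint_pairs ({1..n} - {i, j, k})"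
  let ?T = "Sigma ?I ?D"
  let ?F = "\<lambda>((i, j, k), (X, Y)). two_block_family n c \<alpha> \<beta> i j k X Y"
  have finI: "finite ?I"
    by (rule finite_subset[of _ "{..Suc n} \<times> {..Suc n} \<times> {..Suc n}"]) auto
  have finD: "finite (?D t)" for t
    by (cases t) auto
  have union: "{(P, col) \<in> eq_avoiders_aab n c \<alpha> \<beta>. \<not> (\<exists>X\<in>P. color_class n \<alpha> col \<subseteq> X)} =
      (\<Union>t\<in>?T. ?F t)"
    (is "?L = ?R")
  proof (intro set_eqI iffI)
    fix q assume q: "q \<in> ?L"
    obtain P col where Pcol: "q = (P, col)" by fastforce
    have mem: "(P, col) \<in> eq_avoiders_aab n c \<alpha> \<beta>" "\<not> (\<exists>X\<in>P. color_class n \<alpha> col \<subseteq> X)"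
      using q Pcol by auto
    have "\<Union>P = {1..n}"
      using mem(1) by (auto simp: eq_avoiders_aab_def colored_partitions_def partition_on_def)
    then have "P \<noteq> {}"
      using \<open>n \<ge> 1\<close> by auto
    from two_block_family_exists[OF colors(1,3) mem this]
    obtain i j k X Y where ijk: "1 \<le> i" "i < j" "j < k" "k \<le> Suc n"
      "(X, Y) \<in> disjoint_pairs ({1..n} - {i, j, k})"
      "(P, col) \<in> two_block_family n c \<alpha> \<beta> i j k X Y"
      by blast
    then have "((i, j, k), (X, Y)) \<in> ?T"
      by simp
    moreover have "q \<in> ?F ((i, j, k), (X, Y))"
      using ijk(6) Pcol by simp
    ultimately show "q \<in> ?R"
      by (rule UN_I)
  next
    fix q assume "q \<in> ?R"
    then obtain t where t: "t \<in> ?T" "q \<in> ?F t" by blast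
    obtain i j k X Y P col where [simp]: "t = ((i, j, k), (X, Y))" "q = (P, col)"
      by (metis surj_pair)
    from t show "q \<in> ?L"
      using two_block_family_avoids[OF colors(1,3), of i j k n X Y P col] by simp
  qed
  have "card (\<Union>t\<in>?T. ?F t) = (\<Sum>t\<in>?T. card (?F t))"
  proof (rule card_UN_disjoint)
    show "finite ?T"
      using finI finD by (rule finite_SigmaI)
    show "\<forall>t\<in>?T. finite (?F t)"
      by (auto simp: finite_two_block_family)
    show "\<forall>t\<in>?T. \<forall>t'\<in>?T. t \<noteq> t' \<longrightarrow> ?F t \<inter> ?F t' = {}"
    proof (intro ballI impI equals0I)
      fix t t' q assume t: "t \<in> ?T" "t' \<in> ?T" "t \<noteq> t'" "q \<in> ?F t \<inter> ?F t'"
      obtain i j k X Y i' j' k' X' Y' P col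
        where [simp]: "t = ((i, j, k), (X, Y))" "t' = ((i', j', k'), (X', Y'))" "q = (P, col)"
        by (metis surj_pair)
      show False
        using t two_block_family_unique[OF colors(1,3), of i j k n X Y P col i' j' k' X' Y'] by simp
    qed
  qed
  also have "\<dots> = (\<Sum>(s, p)\<in>?T. card (?F (s, p)))"
    by (rule sum.cong[OF refl]) (simp only: split_paired_all prod.case)
  also have "\<dots> = (\<Sum>s\<in>?I. \<Sum>p\<in>?D s. card (?F (s, p)))"
    by (rule sum.Sigma[symmetric]) (use finI finD in blast)+
  also have "\<dots> = (\<Sum>(i, j, k)\<in>?I. \<Sum>(X, Y)\<in>disjoint_pairs ({1..n} - {i, j, k}).
      card (two_block_family n c \<alpha> \<beta> i j k X Y))"
  proof (rule sum.cong[OF refl])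
    fix s :: "nat \<times> nat \<times> nat"
    obtain i j k where s: "s = (i, j, k)"
      by (metis surj_pair)
    show "(\<Sum>p\<in>?D s. card (?F (s, p))) = (case s of (i, j, k) \<Rightarrow>
        \<Sum>(X, Y)\<in>disjoint_pairs ({1..n} - {i, j, k}). card (two_block_family n c \<alpha> \<beta> i j k X Y))"
      unfolding s prod.case by (rule sum.cong[OF refl]) (simp only: split_paired_all prod.case)
  qed
  finally show ?thesis
    unfolding union .
qed

lemma card_eq_avoiders_split:
  assumes "n \<ge> 1"
  shows "card (eq_avoiders_aab n c \<alpha> \<beta>) =
    card {(P, col) \<in> eq_avoiders_aab n c \<alpha> \<beta>. color_class n \<alpha> col = {}}
  + card {(P, col) \<in> eq_avoiders_aab n c \<alpha> \<beta>.
      color_class n \<alpha> col \<noteq> {} \<and> (\<exists>X\<in>P. color_class n \<alpha> col \<subseteq> X)}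
  + card {(P, col) \<in> eq_avoiders_aab n c \<alpha> \<beta>. \<not> (\<exists>X\<in>P. color_class n \<alpha> col \<subseteq> X)}"
    (is "card ?S = card ?A + card ?B + card ?C")
proof -
  \<comment> \<open>An existing block contains the empty class, which separates \<open>?A\<close>
    from \<open>?C\<close>.\<close>
  have "P \<noteq> {}" if "(P, col) \<in> ?S" for P col
  proof -
    have "\<Union>P = {1..n}"
      using that by (auto simp: eq_avoiders_aab_def colored_partitions_def partition_on_def)
    then show ?thesis
      using assms by auto
  qed
  then have disj: "?A \<inter> ?B = {}" "(?A \<union> ?B) \<inter> ?C = {}"
    by fastforce+
  have "?S = ?A \<union> ?B \<union> ?C"
    by auto
  moreover have "finite ?A" "finite ?B" "finite ?C"
    using finite_eq_avoiders[of n c \<alpha> \<beta>] by (auto intro: finite_subset[rotated])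
  ultimately show ?thesis
    using disj by (metis (no_types, lifting) card_Un_disjoint finite_Un)
qed

theorem theorem5p6:
  fixes n c \<alpha> \<beta> :: nat
  assumes "n \<ge> 1" and "c \<ge> 2"
    and "\<alpha> \<in> {1..c}" and "\<beta> \<in> {1..c}" and "\<alpha> \<noteq> \<beta>"
  shows "card (eq_avoiders_aab n c \<alpha> \<beta>) =
      Bell n * (c - 1) ^ n
    + (\<Sum>i=1..n. (n choose i) *
        (\<Sum>j=0..n-i. ((n - i) choose j) * Bell (n - i - j) * (c - 1) ^ (n - i)))
    + (\<Sum>(i, j)\<in>{(i, j). 1 \<le> i \<and> i < j \<and> j \<le> n}.
        \<Sum>a\<le>n. \<Sum>b\<le>n. \<Sum>d\<le>n. \<Sum>e\<le>n. \<Sum>f\<le>n. \<Sum>g\<le>n.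
          trinomial (i - 1) a b * trinomial (j - i - 1) d e * trinomial (n - j) f g
          * Bell (n - a - b - d - e - f - g - 2)
          * (c - 2) ^ (n - j - f - g) * (c - 1) ^ (j - d - 2) * c ^ (d + f + g))
    + (\<Sum>(i, j, k)\<in>{(i, j, k). 1 \<le> i \<and> i < j \<and> j < k \<and> k \<le> n}.
        \<Sum>a\<le>n. \<Sum>b\<le>n. \<Sum>d\<le>n. \<Sum>e\<le>n. \<Sum>f\<le>n. \<Sum>g\<le>n. \<Sum>l\<le>n. \<Sum>m\<le>n. \<Sum>p\<le>n.
          trinomial (i - 1) a b * trinomial (j - i - 1) d e * trinomial (k - j - 1) f g
          * trinomial (n - k) l m
          * ((n - a - b - d - e - f - g - l - m - 3) choose p)
          * Bell (n - a - b - d - e - f - g - l - m - p - 3)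
          * (c - 2) ^ (k - j - f - g - 1) * (c - 1) ^ (n - k + j - d - 2) * c ^ (d + f + g))"
proof -
  let ?I = "{(i, j, k). 1 \<le> i \<and> i < j \<and> j < k \<and> k \<le> Suc n}"
  let ?I2 = "{(i, j). 1 \<le> i \<and> i < j \<and> j \<le> n}"
  let ?I3 = "{(i, j, k). 1 \<le> i \<and> i < j \<and> j < k \<and> k \<le> n}"
  let ?f = "\<lambda>(i, j, k). \<Sum>(X, Y)\<in>disjoint_pairs ({1..n} - {i, j, k}).
    card (two_block_family n c \<alpha> \<beta> i j k X Y)"
  have fin: "finite ?I2" "finite ?I3"
    by (rule finite_subset[of _ "{..n} \<times> {..n}"] finite_subset[of _ "{..n} \<times> {..n} \<times> {..n}"]; auto)+
  \<comment> \<open>Triples with \<open>k = Suc n\<close> yield the sum over pairs, those with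
    \<open>k \<le> n\<close> the sum over triples in the formula.\<close>
  have "?I = (\<lambda>(i, j). (i, j, Suc n)) ` ?I2 \<union> ?I3"
    by (auto simp: image_iff le_Suc_eq)
  moreover have "(\<lambda>(i, j). (i, j, Suc n)) ` ?I2 \<inter> ?I3 = {}"
    by auto
  ultimately have "sum ?f ?I = sum ?f ((\<lambda>(i, j). (i, j, Suc n)) ` ?I2) + sum ?f ?I3"
    using fin by (simp only: sum.union_disjoint finite_imageI)
  also have "sum ?f ((\<lambda>(i, j). (i, j, Suc n)) ` ?I2) = (\<Sum>(i, j)\<in>?I2. ?f (i, j, Suc n))"
    by (subst sum.reindex) (auto simp: inj_on_def case_prod_unfold)
  finally have split: "sum ?f ?I = (\<Sum>(i, j)\<in>?I2. ?f (i, j, Suc n)) + sum ?f ?I3" .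
  have two: "(\<Sum>(i, j)\<in>?I2. ?f (i, j, Suc n)) = (\<Sum>(i, j)\<in>?I2.
        \<Sum>a\<le>n. \<Sum>b\<le>n. \<Sum>d\<le>n. \<Sum>e\<le>n. \<Sum>f\<le>n. \<Sum>g\<le>n.
          trinomial (i - 1) a b * trinomial (j - i - 1) d e * trinomial (n - j) f g
          * Bell (n - a - b - d - e - f - g - 2)
          * (c - 2) ^ (n - j - f - g) * (c - 1) ^ (j - d - 2) * c ^ (d + f + g))"
    by (rule sum.cong[OF refl], clarsimp simp only: split_paired_all prod.case mem_Collect_eq,
        rule sum_card_two_block_family_two[OF assms(3-5)])
  have three: "sum ?f ?I3 = (\<Sum>(i, j, k)\<in>?I3.
        \<Sum>a\<le>n. \<Sum>b\<le>n. \<Sum>d\<le>n. \<Sum>e\<le>n. \<Sum>f\<le>n. \<Sum>g\<le>n. \<Sum>l\<le>n. \<Sum>m\<le>n. \<Sum>p\<le>n.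
          trinomial (i - 1) a b * trinomial (j - i - 1) d e * trinomial (k - j - 1) f g
          * trinomial (n - k) l m
          * ((n - a - b - d - e - f - g - l - m - 3) choose p)
          * Bell (n - a - b - d - e - f - g - l - m - p - 3)
          * (c - 2) ^ (k - j - f - g - 1) * (c - 1) ^ (n - k + j - d - 2) * c ^ (d + f + g))"
    by (rule sum.cong[OF refl], clarsimp simp only: split_paired_all prod.case mem_Collect_eq,
        rule sum_card_two_block_family_three[OF assms(3-5)])
  show ?thesis
    unfolding card_eq_avoiders_split[OF assms(1)] card_avoiders_no_block[OF assms(3)]
      card_avoiders_one_block[OF assms(3)] card_avoiders_several_blocks[OF assms(3-5,1)]
      split two three by (simp only: add.assoc)
qed

end
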